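(* Let $p_n\to\infty$ and, for each $n$, let $(u_{p_n},v_{p_n})\in X^*_{s,t,p_n}(\Omega)$ satisfy $u_{p_n}>0$, $v_{p_n}>0$ in $\Omega$, $|u_{p_n}(x_1)|^{\alpha(p_n)}|v_{p_n}(x_2)|^{\beta(p_n)}=1$ and $\Lambda_1(p_n)=Q_{s,t,p_n}(u_{p_n},v_{p_n})$; let $x_n$, $y_n$ be maximum points of $u_{p_n}$, $v_{p_n}$, respectively. Let $(u_\infty,v_\infty)\in C_0^{0,s}(\overline\Omega)\times C_0^{0,s}(\overline\Omega)$ be the uniform limit of (a subsequence of) $(u_{p_n},v_{p_n})$, where along the subsequence $x_n\to x_\infty\in\Omega$ and $y_n\to y_\infty\in\Omega$, maximum points of $u_\infty$ and $v_\infty$, with $u_\infty,v_\infty\ge0$, $|u_\infty(x_\infty)|^\theta|v_\infty(y_\infty)|^{1-\theta}=1$ and $\lim_{n\to\infty}\sqrt[p_n]{\Lambda_1(p_n)}=\max\{|u_\infty|_s,|v_\infty|_t\}=R^{-(s\theta+(1-\theta)t)}$, and, if $s=t$, $u_\infty(x),v_\infty(x)\le\left(\mathrm{dist}(x,\mathbb{R}^N\setminus\Omega)\right)^s/R^s$ for all $x$. Then $u=u_\infty$ and $v=v_\infty$ are viscosity solutions of the problems $$\left\{\begin{array}{ll}\mathcal{L}_{s,\infty}u=0&\text{in }\Omega\setminus\{x_1\},\\ u=0&\text{in }\mathbb{R}^N\setminus\Omega,\\ u(x_1)=u_\infty(x_1)\end{array}\right.\qquad\text{and}\qquad\left\{\begin{array}{ll}\mathcal{L}_{t,\infty}v=0&\text{in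 }\Omega\setminus\{x_2\},\\ v=0&\text{in }\mathbb{R}^N\setminus\Omega,\\ v(x_2)=v_\infty(x_2),\end{array}\right.$$ respectively.
   Context: Let $\Omega\subset\mathbb{R}^N$ be a bounded, smooth domain, $0<s\le t<1$, and let $x_1,x_2\in\Omega$ with $x_1\ne x_2$. Let $\alpha,\beta\colon\left(\frac{N}{s},\infty\right)\to(1,\infty)$ satisfy $\alpha(p)+\beta(p)=p$ for all $p\in\left(\frac{N}{s},\infty\right)$ and $\lim_{p\to\infty}\alpha(p)/p=\theta\in(0,1)$. Let $R=\max_{x\in\overline\Omega}\mathrm{dist}(x,\mathbb{R}^N\setminus\Omega)$. For $0<r<1$ and $1\le p<\infty$ let $[u]_{r,p}^p=\int_{\mathbb{R}^N}\int_{\mathbb{R}^N}\frac{|u(x)-u(y)|^p}{|x-y|^{N+rp}}\,dx\,dy$ and $W^{r,p}_0(\Omega)=\{u\in L^p(\mathbb{R}^N): u=0 \text{ in }\mathbb{R}^N\setminus\Omega,\ [u]_{r,p}<\infty\}$. For $p>N/s$ the elements of $W^{s,p}_0(\Omega)$ and $W^{t,p}_0(\Omega)$ are identified with their continuous representatives. For $0<\sigma<1$ let $|u|_\sigma=\sup_{y\ne x}\frac{|u(x)-u(y)|}{|x-y|^\sigma}$; $C_0^{0,\sigma}(\overline\Omega)$ is the space of continuous functions $u$ vanishing in $\mathbb{R}^N\setminus\Omega$ with $|u|_\sigma<\infty$. Put $X_{s,t,p}(\Omega)=W^{s,p}_0(\Omega)\times W^{t,p}_0(\Omega)$ and $X^*_{s,t,p}(\Omega)=\{(u,v)\in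 X_{s,t,p}(\Omega):u(x_1)v(x_2)\ne0\}$. For $p\in\left(\frac{N}{s},\infty\right)$ and $(u,v)\in X^*_{s,t,p}(\Omega)$ define $$Q_{s,t,p}(u,v)=\frac{\frac1p[u]_{s,p}^p+\frac1p[v]_{t,p}^p}{|u(x_1)|^{\alpha(p)}|v(x_2)|^{\beta(p)}},\qquad\Lambda_1(p)=\inf_{(u,v)\in X^*_{s,t,p}(\Omega)}Q_{s,t,p}(u,v).$$ For $0<\sigma<1$ define $$(\mathcal{L}_{\sigma,\infty}u)(x)=\sup_{y\in\mathbb{R}^N\setminus\{x\}}\frac{u(y)-u(x)}{|y-x|^\sigma}+\inf_{y\in\mathbb{R}^N\setminus\{x\}}\frac{u(y)-u(x)}{|y-x|^\sigma}.$$ Viscosity solutions: let $D\subset\Omega$ be open. A function $w\in C(\mathbb{R}^N)$ with $w=0$ in $\mathbb{R}^N\setminus\Omega$ is a viscosity supersolution of $\mathcal{L}_{\sigma,\infty}w=0$ in $D$ if $(\mathcal{L}_{\sigma,\infty}\varphi)(z)\le0$ for each pair $(z,\varphi)\in D\times C_0^1(\mathbb{R}^N)$ with $\varphi(z)=w(z)$ and $\varphi\le w$ in $\mathbb{R}^N$; a viscosity subsolution if $(\mathcal{L}_{\sigma,\infty}\varphi)(z)\ge0$ for each pair $(z,\varphi)\in D\times C_0^1(\mathbb{R}^N)$ with $\varphi(z)=w(z)$ and $\varphi\ge w$ in $\mathbb{R}^N$; and a viscosity solution if it is both. *)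

theory Defs
  imports "HOL-Analysis.Analysis"
begin

(* C^k regularity on an open set: f is differentiable, and every directional
   derivative of f is C^(k-1). *)
primrec C_k_on :: "nat \<Rightarrow> 'a::euclidean_space set \<Rightarrow> ('a \<Rightarrow> real) \<Rightarrow> bool" where
  "C_k_on 0 S f \<longleftrightarrow> continuous_on S f"
| "C_k_on (Suc k) S f \<longleftrightarrow>
     (\<forall>x\<in>S. f differentiable (at x)) \<and>
     (\<forall>e. C_k_on k S (\<lambda>x. frechet_derivative f (at x) e))"

definition C_inf_on :: "'a::euclidean_space set \<Rightarrow> ('a \<Rightarrow> real) \<Rightarrow> bool" where
  "C_inf_on S f \<longleftrightarrow> (\<forall>k. C_k_on k S f)"

(* Near each boundary point the domain is the part lying above a smooth graph over the
   hyperplane orthogonal to some unit vector e; x - (x \<bullet> e) *\<^sub>R e is the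
   orthogonal projection of x to that hyperplane. *)
definition bounded_smooth_domain :: "'a::euclidean_space set \<Rightarrow> bool" where
  "bounded_smooth_domain \<Omega> \<longleftrightarrow>
     open \<Omega> \<and> connected \<Omega> \<and> \<Omega> \<noteq> {} \<and> bounded \<Omega> \<and>
     (\<forall>z\<in>frontier \<Omega>. \<exists>r>0. \<exists>e. \<exists>\<gamma> :: 'a \<Rightarrow> real.
        norm e = 1 \<and> C_inf_on UNIV \<gamma> \<and>
        \<Omega> \<inter> ball z r = {x \<in> ball z r. x \<bullet> e > \<gamma> (x - (x \<bullet> e) *\<^sub>R e)})"

(* The supremum is attained: the distance is continuous and the closure is compact. *)
definition inradius :: "'a::euclidean_space set \<Rightarrow> real" where
  "inradius \<Omega> = (SUP x\<in>closure \<Omega>. infdist x (- \<Omega>))"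

(* The p-th power of the Gagliardo seminorm; the integrand is 0 on the diagonal,
   a null set. *)
definition gagliardo_pow :: "real \<Rightarrow> real \<Rightarrow> ('a::euclidean_space \<Rightarrow> real) \<Rightarrow> ennreal" where
  "gagliardo_pow r p u =
     (\<integral>\<^sup>+ x. \<integral>\<^sup>+ y.
        ennreal (\<bar>u x - u y\<bar> powr p / norm (x - y) powr (real DIM('a) + r * p))
      \<partial>lborel \<partial>lborel)"

definition W0 :: "real \<Rightarrow> real \<Rightarrow> 'a::euclidean_space set \<Rightarrow> ('a \<Rightarrow> real) set" where
  "W0 r p \<Omega> = {u. u \<in> borel_measurable lborel \<and>
                  integrable lborel (\<lambda>x. \<bar>u x\<bar> powr p) \<and>
                  (\<forall>x. x \<notin> \<Omega> \<longrightarrow> u x = 0) \<and>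
                  gagliardo_pow r p u < \<infinity>}"

(* For p > N/s, elements of the two factors are identified with their continuous
   representatives. *)
definition X_space ::
  "real \<Rightarrow> real \<Rightarrow> real \<Rightarrow> 'a::euclidean_space set \<Rightarrow> (('a \<Rightarrow> real) \<times> ('a \<Rightarrow> real)) set" where
  "X_space s t p \<Omega> = {u \<in> W0 s p \<Omega>. continuous_on UNIV u} \<times> {v \<in> W0 t p \<Omega>. continuous_on UNIV v}"

definition X_star ::
  "real \<Rightarrow> real \<Rightarrow> real \<Rightarrow> 'a::euclidean_space set \<Rightarrow> 'a \<Rightarrow> 'a \<Rightarrow> (('a \<Rightarrow> real) \<times> ('a \<Rightarrow> real)) set"
  where
  "X_star s t p \<Omega> x1 x2 = {(u, v) \<in> X_space s t p \<Omega>. u x1 * v x2 \<noteq> 0}"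

definition Q_quot ::
  "real \<Rightarrow> real \<Rightarrow> (real \<Rightarrow> real) \<Rightarrow> (real \<Rightarrow> real) \<Rightarrow> 'a::euclidean_space \<Rightarrow> 'a \<Rightarrow> real
    \<Rightarrow> ('a \<Rightarrow> real) \<Rightarrow> ('a \<Rightarrow> real) \<Rightarrow> real" where
  "Q_quot s t \<alpha> \<beta> x1 x2 p u v =
     (1 / p * enn2real (gagliardo_pow s p u) + 1 / p * enn2real (gagliardo_pow t p v)) /
     (\<bar>u x1\<bar> powr \<alpha> p * \<bar>v x2\<bar> powr \<beta> p)"

definition Lambda1 ::
  "real \<Rightarrow> real \<Rightarrow> (real \<Rightarrow> real) \<Rightarrow> (real \<Rightarrow> real) \<Rightarrow> 'a::euclidean_space set \<Rightarrow> 'a \<Rightarrow> 'a \<Rightarrow> real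
    \<Rightarrow> real" where
  "Lambda1 s t \<alpha> \<beta> \<Omega> x1 x2 p =
     (INF (u, v)\<in>X_star s t p \<Omega> x1 x2. Q_quot s t \<alpha> \<beta> x1 x2 p u v)"

definition holder_seminorm :: "real \<Rightarrow> ('a::euclidean_space \<Rightarrow> real) \<Rightarrow> ennreal" where
  "holder_seminorm \<sigma> u =
     (SUP (x, y)\<in>{(x, y). y \<noteq> x}. ennreal (\<bar>u x - u y\<bar> / norm (x - y) powr \<sigma>))"

definition holder_space0 :: "real \<Rightarrow> 'a::euclidean_space set \<Rightarrow> ('a \<Rightarrow> real) set" where
  "holder_space0 \<sigma> \<Omega> =
     {u. continuous_on UNIV u \<and> (\<forall>x. x \<notin> \<Omega> \<longrightarrow> u x = 0) \<and> holder_seminorm \<sigma> u < \<infinity>}"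

(* Real-valued sup and inf: for 0 < \<sigma> < 1 the quotients are bounded when \<phi> is bounded
   and Lipschitz, in particular for the test functions below. *)
definition L_inf :: "real \<Rightarrow> ('a::euclidean_space \<Rightarrow> real) \<Rightarrow> 'a \<Rightarrow> real" where
  "L_inf \<sigma> \<phi> x =
     (SUP y\<in>UNIV - {x}. (\<phi> y - \<phi> x) / norm (y - x) powr \<sigma>) +
     (INF y\<in>UNIV - {x}. (\<phi> y - \<phi> x) / norm (y - x) powr \<sigma>)"

definition C1_compact_support :: "('a::euclidean_space \<Rightarrow> real) set" where
  "C1_compact_support = {\<phi>. C_k_on 1 UNIV \<phi> \<and> compact (closure {x. \<phi> x \<noteq> 0})}"

definition viscosity_supersolution ::
  "real \<Rightarrow> 'a::euclidean_space set \<Rightarrow> 'a set \<Rightarrow> ('a \<Rightarrow> real) \<Rightarrow> bool" where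
  "viscosity_supersolution \<sigma> \<Omega> D w \<longleftrightarrow>
     continuous_on UNIV w \<and> (\<forall>x. x \<notin> \<Omega> \<longrightarrow> w x = 0) \<and>
     (\<forall>z\<in>D. \<forall>\<phi>\<in>C1_compact_support. \<phi> z = w z \<and> (\<forall>x. \<phi> x \<le> w x) \<longrightarrow> L_inf \<sigma> \<phi> z \<le> 0)"

definition viscosity_subsolution ::
  "real \<Rightarrow> 'a::euclidean_space set \<Rightarrow> 'a set \<Rightarrow> ('a \<Rightarrow> real) \<Rightarrow> bool" where
  "viscosity_subsolution \<sigma> \<Omega> D w \<longleftrightarrow>
     continuous_on UNIV w \<and> (\<forall>x. x \<notin> \<Omega> \<longrightarrow> w x = 0) \<and>
     (\<forall>z\<in>D. \<forall>\<phi>\<in>C1_compact_support. \<phi> z = w z \<and> (\<forall>x. \<phi> x \<ge> w x) \<longrightarrow> L_inf \<sigma> \<phi> z \<ge> 0)"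

definition viscosity_solution ::
  "real \<Rightarrow> 'a::euclidean_space set \<Rightarrow> 'a set \<Rightarrow> ('a \<Rightarrow> real) \<Rightarrow> bool" where
  "viscosity_solution \<sigma> \<Omega> D w \<longleftrightarrow>
     viscosity_supersolution \<sigma> \<Omega> D w \<and> viscosity_subsolution \<sigma> \<Omega> D w"

definition solves_punctured_problem ::
  "real \<Rightarrow> 'a::euclidean_space set \<Rightarrow> 'a \<Rightarrow> real \<Rightarrow> ('a \<Rightarrow> real) \<Rightarrow> bool" where
  "solves_punctured_problem \<sigma> \<Omega> x0 c w \<longleftrightarrow>
     viscosity_solution \<sigma> \<Omega> (\<Omega> - {x0}) w \<and> (\<forall>x. x \<notin> \<Omega> \<longrightarrow> w x = 0) \<and> w x0 = c"

end

theory Submission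
  imports Defs
begin

text \<open>
  Each \<open>u\<^sub>p\<close> minimises the Gagliardo energy among all competitors with the same value at
  \<open>x\<^sub>1\<close>, since replacing the first component leaves the denominator of the quotient unchanged.
  Suppose \<open>\<phi>\<close> touches the limit from below at \<open>z\<close> but the operator is positive at \<open>z\<close>. After making
  the contact strict, lifting \<open>u\<^sub>p\<close> to \<open>max u\<^sub>p (\<phi> + c)\<close> changes it only near \<open>z\<close>, by some
  \<open>\<eta> \<ge> 0\<close>, and convexity of \<open>t \<mapsto> \<bar>t\<bar>^p\<close> bounds the energy increase by
  \<open>2 p \<integral> \<eta> (A - B)\<close>, where \<open>A\<close> and \<open>B\<close> are the integrals over \<open>y\<close> of the \<open>(p - 1)\<close>-th powers of the
  positive parts of \<open>\<phi> x - \<phi> y\<close> and \<open>\<phi> y - \<phi> x\<close> against the kernel. Near \<open>z\<close>, \<open>A\<close> grows like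
  \<open>b^p\<close> and \<open>B\<close> like \<open>a^p\<close> with \<open>b < a\<close>, so for large \<open>p\<close> the lift would strictly lower the energy.
  Subsolutions follow by changing signs.
\<close>

section \<open>The energy of a lift\<close>

text \<open>This is the odd power sgn(d) |d|^r. Writing it as a difference of one-sided powers lets
  the energy estimate split into two nonnegative parts.\<close>

definition signed_powr :: "real \<Rightarrow> real \<Rightarrow> real" where
  "signed_powr r d = max 0 d powr r - max 0 (- d) powr r"

lemma signed_powr_mono:
  assumes "0 \<le> r" "d \<le> e"
  shows "signed_powr r d \<le> signed_powr r e"
  unfolding signed_powr_def
  by (rule diff_mono; rule powr_mono2) (use assms in auto)

text \<open>The convex function |t|^p lies above its tangent at \<open>b\<close>, where its slope is
  \<open>p * signed_powr (p - 1) b\<close>. Young's inequality with the conjugate exponents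
  \<open>p\<close> and \<open>q\<close> gives this without differentiating.\<close>

lemma signed_powr_tangent:
  assumes "1 < p"
  shows "\<bar>b\<bar> powr p + p * (signed_powr (p - 1) b * (a - b)) \<le> \<bar>a\<bar> powr p"
proof -
  define q where "q = p / (p - 1)"
  have q: "q > 1" "1 / p + 1 / q = 1" "(p - 1) * q = p"
    using assms by (auto simp: q_def field_simps)
  have "\<bar>a\<bar> * \<bar>b\<bar> powr (p - 1) \<le> \<bar>a\<bar> powr p / p + (\<bar>b\<bar> powr (p - 1)) powr q / q"
    using assms q by (intro Youngs_inequality) auto
  also have "(\<bar>b\<bar> powr (p - 1)) powr q = \<bar>b\<bar> powr p"
    using q by (simp add: powr_powr)
  finally have "p * (\<bar>a\<bar> * \<bar>b\<bar> powr (p - 1)) \<le> p * (\<bar>a\<bar> powr p / p + \<bar>b\<bar> powr p / q)"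
    using assms by (intro mult_left_mono) auto
  also have "\<dots> = \<bar>a\<bar> powr p + (p - 1) * \<bar>b\<bar> powr p"
    using assms by (simp add: q_def field_simps)
  finally have young: "p * (\<bar>a\<bar> * \<bar>b\<bar> powr (p - 1)) \<le> \<bar>a\<bar> powr p + (p - 1) * \<bar>b\<bar> powr p" .
  have sb: "signed_powr (p - 1) b * b = \<bar>b\<bar> powr p"
    using assms powr_mult_base[of "\<bar>b\<bar>" "p - 1"]
    by (cases "b \<ge> 0") (auto simp: signed_powr_def max_def mult.commute split: if_splits)
  have "\<bar>signed_powr (p - 1) b\<bar> = \<bar>b\<bar> powr (p - 1)"
    using assms by (auto simp: signed_powr_def max_def split: if_splits)
  then have "signed_powr (p - 1) b * a \<le> \<bar>a\<bar> * \<bar>b\<bar> powr (p - 1)"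
    by (metis abs_ge_self abs_mult mult.commute)
  then have "p * (signed_powr (p - 1) b * a) \<le> p * (\<bar>a\<bar> * \<bar>b\<bar> powr (p - 1))"
    using assms by (intro mult_left_mono) auto
  with young sb show ?thesis
    by (simp add: algebra_simps)
qed

text \<open>The tangent inequality is taken at the lift: where \<open>\<eta>\<close> is positive, the lift is \<open>\<phi> + c\<close>, and it is
  at least \<open>\<phi> + c\<close> everywhere, so its increments compare with those of \<open>\<phi>\<close>.\<close>

lemma lift_energy_pointwise:
  fixes u \<phi> \<eta> :: "'a \<Rightarrow> real"
  assumes "1 < p" and \<eta>: "\<And>x. \<eta> x = max 0 (\<phi> x + c - u x)"
  shows "\<bar>(u x + \<eta> x) - (u y + \<eta> y)\<bar> powr p
      + (p * (max 0 (\<phi> y - \<phi> x) powr (p - 1) * \<eta> x) + p * (max 0 (\<phi> x - \<phi> y) powr (p - 1) * \<eta> y))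
    \<le> \<bar>u x - u y\<bar> powr p
      + (p * (max 0 (\<phi> x - \<phi> y) powr (p - 1) * \<eta> x) + p * (max 0 (\<phi> y - \<phi> x) powr (p - 1) * \<eta> y))"
proof -
  let ?S = "signed_powr (p - 1)"
  define d where "d = (u x + \<eta> x) - (u y + \<eta> y)"
  define e where "e = \<phi> x - \<phi> y"
  have 1: "?S d * \<eta> x \<le> ?S e * \<eta> x"
  proof (cases "\<eta> x > 0")
    case True
    then have "d \<le> e" unfolding d_def e_def \<eta> by (auto simp: max_def split: if_splits)
    then show ?thesis
      using True assms(1) by (intro mult_right_mono signed_powr_mono) auto
  qed (auto simp: \<eta>)
  have 2: "?S e * \<eta> y \<le> ?S d * \<eta> y"
  proof (cases "\<eta> y > 0")
    case True
    then have "e \<le> d" unfolding d_def e_def \<eta> by (auto simp: max_def split: if_splits)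
    then show ?thesis
      using True assms(1) by (intro mult_right_mono signed_powr_mono) auto
  qed (auto simp: \<eta>)
  have "u x - u y - d = - (\<eta> x - \<eta> y)" by (simp add: d_def)
  then have "\<bar>d\<bar> powr p \<le> \<bar>u x - u y\<bar> powr p + p * (?S d * (\<eta> x - \<eta> y))"
    using signed_powr_tangent[OF assms(1), of d "u x - u y"] by (simp only: mult_minus_right)
  also have "p * (?S d * (\<eta> x - \<eta> y)) \<le> p * (?S e * \<eta> x - ?S e * \<eta> y)"
    using assms(1) 1 2 by (intro mult_left_mono) (auto simp: algebra_simps)
  finally show ?thesis
    by (simp add: d_def e_def signed_powr_def algebra_simps)
qed

text \<open>Formally, the value for \<phi> minus the value for \<open>- \<phi>\<close> is, up to a
  constant, the fractional p-Laplacian of \<phi>. Kept apart, the two halves are nonnegative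
  integrals, defined even where they are infinite.\<close>

definition one_sided_op :: "real \<Rightarrow> real \<Rightarrow> ('a::euclidean_space \<Rightarrow> real) \<Rightarrow> 'a \<Rightarrow> ennreal" where
  "one_sided_op \<sigma> p \<phi> x =
     (\<integral>\<^sup>+ y. ennreal (max 0 (\<phi> x - \<phi> y) powr (p - 1) / norm (x - y) powr (real DIM('a) + \<sigma> * p)) \<partial>lborel)"

text \<open>The pointwise inequality is integrated in both variables. Exchanging x and y turns the
  terms with weight \<eta> y into those with weight \<eta> x, whence the factor 2. Every term stands
  on the side where it is added, since infinite values cannot be subtracted in
  \<open>ennreal\<close>.\<close>

lemma gagliardo_pow_lift_le:
  fixes u \<phi> \<eta> :: "'a::euclidean_space \<Rightarrow> real"
  assumes p: "1 < p" and \<eta>: "\<And>x. \<eta> x = max 0 (\<phi> x + c - u x)"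
    and u: "continuous_on UNIV u" and \<phi>: "continuous_on UNIV \<phi>"
  shows "gagliardo_pow \<sigma> p (\<lambda>x. u x + \<eta> x)
      + 2 * (\<integral>\<^sup>+ x. ennreal (p * \<eta> x) * one_sided_op \<sigma> p (\<lambda>z. - \<phi> z) x \<partial>lborel)
    \<le> gagliardo_pow \<sigma> p u
      + 2 * (\<integral>\<^sup>+ x. ennreal (p * \<eta> x) * one_sided_op \<sigma> p \<phi> x \<partial>lborel)"
proof -
  define K :: "'a \<Rightarrow> 'a \<Rightarrow> real" where "K x y = norm (x - y) powr (real DIM('a) + \<sigma> * p)" for x y
  \<comment> \<open>The weight sits at the first argument, so \<open>T \<psi> y x\<close> is the
    partner term with weight \<eta> y; the symmetry of \<open>K\<close> lets one definition serve
    for both.\<close>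
  define T where "T \<psi> x y = ennreal (p * (max 0 (\<psi> x - \<psi> y) powr (p - 1) * \<eta> x) / K x y)"
    for \<psi> :: "'a \<Rightarrow> real" and x y
  define E where "E w x y = ennreal (\<bar>w x - w y\<bar> powr p / K x y)" for w :: "'a \<Rightarrow> real" and x y
  have \<eta>_cont: "continuous_on UNIV \<eta>"
    unfolding \<eta> by (intro continuous_intros u \<phi>)
  have \<eta>_nonneg: "\<eta> x \<ge> 0" for x by (simp add: \<eta>)
  have [measurable]: "u \<in> borel_measurable borel" "\<phi> \<in> borel_measurable borel" "\<eta> \<in> borel_measurable borel"
    using u \<phi> \<eta>_cont by (auto intro: borel_measurable_continuous_onI)
  have K_nonneg: "K x y \<ge> 0" for x y by (simp add: K_def)
  have K_sym: "K x y = K y x" for x y by (simp add: K_def norm_minus_commute)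
  have T_meas[measurable]: "case_prod (T \<psi>) \<in> borel_measurable (lborel \<Otimes>\<^sub>M lborel)"
    if [measurable]: "\<psi> \<in> borel_measurable borel" for \<psi>
    unfolding T_def K_def by measurable
  have E_meas[measurable]: "case_prod (E w) \<in> borel_measurable (lborel \<Otimes>\<^sub>M lborel)"
    if [measurable]: "w \<in> borel_measurable borel" for w
    unfolding E_def K_def by measurable
  have pw: "E (\<lambda>x. u x + \<eta> x) x y + (T (\<lambda>z. - \<phi> z) x y + T (\<lambda>z. - \<phi> z) y x)
      \<le> E u x y + (T \<phi> x y + T \<phi> y x)" for x y
  proof -
    have "(\<bar>(u x + \<eta> x) - (u y + \<eta> y)\<bar> powr p
      + (p * (max 0 (\<phi> y - \<phi> x) powr (p - 1) * \<eta> x) + p * (max 0 (\<phi> x - \<phi> y) powr (p - 1) * \<eta> y))) / K x y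
    \<le> (\<bar>u x - u y\<bar> powr p
      + (p * (max 0 (\<phi> x - \<phi> y) powr (p - 1) * \<eta> x) + p * (max 0 (\<phi> y - \<phi> x) powr (p - 1) * \<eta> y))) / K x y"
      by (intro divide_right_mono lift_energy_pointwise[of p \<eta> \<phi> c u, OF p \<eta>] K_nonneg)
    then show ?thesis
      unfolding E_def T_def
      using p \<eta>_nonneg K_nonneg
      by (simp add: K_sym[of y x] ennreal_plus[symmetric] add_divide_distrib algebra_simps del: ennreal_plus)
  qed
  have TT: "(\<integral>\<^sup>+ x. \<integral>\<^sup>+ y. T \<psi> x y + T \<psi> y x \<partial>lborel \<partial>lborel)
      = 2 * (\<integral>\<^sup>+ x. ennreal (p * \<eta> x) * one_sided_op \<sigma> p \<psi> x \<partial>lborel)"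
    if [measurable]: "\<psi> \<in> borel_measurable borel" for \<psi>
  proof -
    have inner: "(\<integral>\<^sup>+ y. T \<psi> x y \<partial>lborel) = ennreal (p * \<eta> x) * one_sided_op \<sigma> p \<psi> x" for x
    proof -
      have "T \<psi> x y = ennreal (p * \<eta> x) * ennreal (max 0 (\<psi> x - \<psi> y) powr (p - 1) / K x y)" for y
        unfolding T_def using p \<eta>_nonneg by (subst ennreal_mult[symmetric]) (auto simp: K_nonneg algebra_simps)
      then show ?thesis
        unfolding one_sided_op_def by (simp add: nn_integral_cmult K_def)
    qed
    have "(\<integral>\<^sup>+ x. \<integral>\<^sup>+ y. T \<psi> x y + T \<psi> y x \<partial>lborel \<partial>lborel)
      = (\<integral>\<^sup>+ x. (\<integral>\<^sup>+ y. T \<psi> x y \<partial>lborel) + (\<integral>\<^sup>+ y. T \<psi> y x \<partial>lborel) \<partial>lborel)"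
      by (intro nn_integral_cong nn_integral_add) measurable
    also have "\<dots> = (\<integral>\<^sup>+ x. \<integral>\<^sup>+ y. T \<psi> x y \<partial>lborel \<partial>lborel) + (\<integral>\<^sup>+ x. \<integral>\<^sup>+ y. T \<psi> y x \<partial>lborel \<partial>lborel)"
      by (intro nn_integral_add) measurable
    also have "(\<integral>\<^sup>+ x. \<integral>\<^sup>+ y. T \<psi> y x \<partial>lborel \<partial>lborel) = (\<integral>\<^sup>+ x. \<integral>\<^sup>+ y. T \<psi> x y \<partial>lborel \<partial>lborel)"
      by (rule lborel_pair.Fubini') measurable
    finally have "(\<integral>\<^sup>+ x. \<integral>\<^sup>+ y. T \<psi> x y + T \<psi> y x \<partial>lborel \<partial>lborel) = 2 * (\<integral>\<^sup>+ x. \<integral>\<^sup>+ y. T \<psi> x y \<partial>lborel \<partial>lborel)"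
      by (simp add: mult_2)
    then show ?thesis by (simp add: inner)
  qed
  have split: "(\<integral>\<^sup>+ x. \<integral>\<^sup>+ y. E w x y + (T \<psi> x y + T \<psi> y x) \<partial>lborel \<partial>lborel)
     = gagliardo_pow \<sigma> p w + 2 * (\<integral>\<^sup>+ x. ennreal (p * \<eta> x) * one_sided_op \<sigma> p \<psi> x \<partial>lborel)"
    if [measurable]: "\<psi> \<in> borel_measurable borel" "w \<in> borel_measurable borel" for \<psi> w
  proof -
    have "(\<integral>\<^sup>+ x. \<integral>\<^sup>+ y. E w x y + (T \<psi> x y + T \<psi> y x) \<partial>lborel \<partial>lborel)
       = (\<integral>\<^sup>+ x. (\<integral>\<^sup>+ y. E w x y \<partial>lborel) + (\<integral>\<^sup>+ y. T \<psi> x y + T \<psi> y x \<partial>lborel) \<partial>lborel)"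
      by (intro nn_integral_cong nn_integral_add) measurable
    also have "\<dots> = (\<integral>\<^sup>+ x. (\<integral>\<^sup>+ y. E w x y \<partial>lborel) \<partial>lborel) + (\<integral>\<^sup>+ x. (\<integral>\<^sup>+ y. T \<psi> x y + T \<psi> y x \<partial>lborel) \<partial>lborel)"
      by (intro nn_integral_add) measurable
    also note TT[OF that(1)]
    finally show ?thesis by (simp add: gagliardo_pow_def E_def K_def)
  qed
  have "(\<integral>\<^sup>+ x. \<integral>\<^sup>+ y. E (\<lambda>x. u x + \<eta> x) x y + (T (\<lambda>z. - \<phi> z) x y + T (\<lambda>z. - \<phi> z) y x) \<partial>lborel \<partial>lborel)
    \<le> (\<integral>\<^sup>+ x. \<integral>\<^sup>+ y. E u x y + (T \<phi> x y + T \<phi> y x) \<partial>lborel \<partial>lborel)"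
    by (intro nn_integral_mono pw)
  then show ?thesis
    using split[of "\<lambda>z. - \<phi> z" "\<lambda>x. u x + \<eta> x"] split[of \<phi> u] by simp
qed

section \<open>One-sided operators for large exponents\<close>

text \<open>On the dyadic shell 2^k \<le> |x - y| < 2^(k+1) the integrand is at most 2^(-ka), and
  the enclosing ball has volume of order 2^(kN). The sum is a geometric series of ratio 2^(N-a) < 1,
  and translation invariance makes the bound uniform in x.\<close>

lemma nn_integral_norm_powr_far_bounded:
  fixes a :: real
  assumes "real DIM('a::euclidean_space) < a"
  obtains C where "0 \<le> C"
    "\<And>x::'a. (\<integral>\<^sup>+ y. indicator (- ball x 1) y * ennreal (norm (x - y) powr - a) \<partial>lborel) \<le> ennreal C"
proof -
  define N where "N = real DIM('a)"
  define V where "V = unit_ball_vol N"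
  define \<delta> where "\<delta> = a - N"
  have \<delta>: "\<delta> > 0" and N: "N \<ge> 0" and V: "V \<ge> 0" using assms by (auto simp: \<delta>_def N_def V_def)
  define g where "g k = V * 2 powr N * (2 powr - \<delta>) ^ k" for k :: nat
  have lt1: "2 powr - \<delta> < 1" using \<delta> by (simp add: powr_less_one)
  have g_nonneg: "g k \<ge> 0" for k by (simp add: g_def V)
  have sum_g: "summable g" unfolding g_def
    by (intro summable_mult summable_geometric) (use lt1 in auto)
  show thesis
  proof (rule that[of "suminf g"])
    show "0 \<le> suminf g" by (intro suminf_nonneg sum_g g_nonneg)
    fix x :: 'a
    \<comment> \<open>Full balls replace the shells: the overlap only enlarges the upper bound, and
      the volume of a ball is explicit.\<close>
    define f where "f k y = ennreal ((2 ^ k) powr - a) * indicator (ball x (2 ^ Suc k)) y" for k :: nat and y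
    have f_meas: "f k \<in> borel_measurable lborel" for k
    proof -
      have "f k = (\<lambda>y. ennreal ((2 ^ k) powr - a) * indicator (ball x (2 ^ Suc k)) y)"
        by (rule ext) (rule f_def)
      moreover have "(\<lambda>y. ennreal ((2 ^ k) powr - a) * indicator (ball x (2 ^ Suc k)) y) \<in> borel_measurable lborel"
        by (intro borel_measurable_times_ennreal borel_measurable_const borel_measurable_indicator) simp
      ultimately show ?thesis by (simp only:)
    qed
    have le: "indicator (- ball x 1) y * ennreal (norm (x - y) powr - a) \<le> (\<Sum>k. f k y)" for y
    proof (cases "y \<in> ball x 1")
      case False
      define r where "r = norm (x - y)"
      have r: "r \<ge> 1" using False by (simp add: r_def dist_norm)
      \<comment> \<open>This is the index of the shell containing \<open>y\<close>. As
        \<open>r \<ge> 1\<close>, the floor is nonnegative and \<open>nat\<close> loses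
        nothing.\<close>
      define k where "k = nat \<lfloor>log 2 r\<rfloor>"
      have k: "real k \<le> log 2 r" "log 2 r < real k + 1"
        using r by (auto simp: k_def)
      have "2 powr real k \<le> r" using k(1) r le_log_iff[of 2 r "real k"] by simp
      then have k1: "2 ^ k \<le> r" by (simp add: powr_realpow)
      have "r < 2 powr (real (Suc k))" using k(2) r log_less_iff[of 2 r "real k + 1"] by (simp add: add.commute)
      then have k2: "r < 2 ^ Suc k" by (simp only: powr_realpow zero_less_numeral)
      have "ennreal (r powr - a) \<le> ennreal ((2 ^ k) powr - a)"
        using k1 assms N by (intro ennreal_leI powr_mono2') (auto simp: N_def)
      also have "\<dots> = f k y" using k2 by (simp add: f_def r_def dist_norm)
      also have "\<dots> \<le> (\<Sum>k. f k y)"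
        using sum_le_suminf[OF summableI, of "{k}" "\<lambda>k. f k y"] by simp
      finally have "ennreal (norm (x - y) powr - a) \<le> (\<Sum>k. f k y)" unfolding r_def .
      moreover have "indicator (- ball x 1) y = (1::ennreal)" using False by (auto simp: indicator_def)
      ultimately show ?thesis by (simp only: mult_1_left)
    qed (auto simp: indicator_def)
    have fk: "(\<integral>\<^sup>+ y. f k y \<partial>lborel) = ennreal (g k)" for k
    proof -
      have "(\<integral>\<^sup>+ y. f k y \<partial>lborel) = ennreal ((2 ^ k) powr - a) * emeasure lborel (ball x (2 ^ Suc k))"
        unfolding f_def by (subst nn_integral_cmult_indicator) auto
      also have "\<dots> = ennreal ((2 ^ k) powr - a * (V * (2 ^ Suc k) ^ DIM('a)))"
        by (subst emeasure_ball) (auto simp: V_def N_def ennreal_mult)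
      also have "(2 ^ k) powr - a * (V * (2 ^ Suc k) ^ DIM('a)) = g k"
      proof -
        have "(2 ^ k :: real) powr - a = 2 powr (- a * k)"
          by (simp add: powr_realpow[symmetric] powr_powr mult.commute)
        moreover have "((2 ^ Suc k) ^ DIM('a) :: real) = 2 powr (real (Suc k) * N)"
          by (subst power_mult[symmetric], subst powr_realpow[symmetric]) (simp_all add: N_def distrib_right)
        moreover have "(2 powr - \<delta>) ^ k = 2 powr (- \<delta> * k)"
          by (simp add: powr_power mult.commute)
        moreover have "2 powr (- a * k) * 2 powr (real (Suc k) * N) = 2 powr N * 2 powr (- \<delta> * k)"
          unfolding powr_add[symmetric] by (simp add: \<delta>_def algebra_simps)
        ultimately show ?thesis
          by (simp only: g_def mult_ac)
      qed
      finally show ?thesis .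
    qed
    have "(\<integral>\<^sup>+ y. indicator (- ball x 1) y * ennreal (norm (x - y) powr - a) \<partial>lborel)
        \<le> (\<integral>\<^sup>+ y. (\<Sum>k. f k y) \<partial>lborel)"
      by (intro nn_integral_mono le)
    also have "\<dots> = (\<Sum>k. \<integral>\<^sup>+ y. f k y \<partial>lborel)"
      by (rule nn_integral_suminf) (rule f_meas)
    also have "\<dots> = (\<Sum>k. ennreal (g k))"
      by (simp only: fk)
    also have "\<dots> = ennreal (suminf g)"
      by (intro suminf_ennreal2 sum_g g_nonneg)
    finally show "(\<integral>\<^sup>+ y. indicator (- ball x 1) y * ennreal (norm (x - y) powr - a) \<partial>lborel) \<le> ennreal (suminf g)" .
  qed
qed

text \<open>Of the p - 1 powers of the increment, q are reserved for integrability and the Hoelder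
  hypothesis turns the rest into powers of \<open>b\<close>. Since \<open>C\<close> and
  \<open>q\<close> are fixed before \<open>p\<close> and \<open>x\<close>, the bound depends on
  \<open>p\<close> only through a power of \<open>b\<close>.\<close>

lemma one_sided_op_upper:
  fixes \<phi> :: "'a::euclidean_space \<Rightarrow> real"
  assumes \<sigma>: "0 < \<sigma>" "\<sigma> < 1" and "0 \<le> L" "0 < b"
    and lip: "\<And>x y. \<bar>\<phi> x - \<phi> y\<bar> \<le> L * norm (x - y)" and M: "\<And>x. \<bar>\<phi> x\<bar> \<le> M"
  obtains C q where "0 \<le> C" "\<And>p x. q + 1 \<le> p \<Longrightarrow>
      (\<And>y. \<phi> x - \<phi> y \<le> b * norm (x - y) powr \<sigma>) \<Longrightarrow>
      one_sided_op \<sigma> p \<phi> x \<le> ennreal (b powr (p - 1 - q) * C)"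
proof -
  define N where "N = real DIM('a)"
  \<comment> \<open>Splitting off the \<open>q\<close>-th power leaves the kernel exponent \<open>- (N + \<sigma> + \<sigma> q) = - q\<close>, which the
      Lipschitz bound cancels near the diagonal and which is integrable at infinity.\<close>
  define q where "q = (N + \<sigma>) / (1 - \<sigma>)"
  have N: "N > 0" by (simp add: N_def)
  have q: "q > 0" "q = N + \<sigma> + \<sigma> * q" using \<sigma> N by (auto simp: q_def field_simps)
  define a where "a = N + \<sigma> + \<sigma> * q"
  have a: "a = q" "a > N" using q \<sigma> mult_pos_pos[of \<sigma> q] unfolding a_def by linarith+
  obtain C0 where C0: "0 \<le> C0"
    "\<And>x::'a. (\<integral>\<^sup>+ y. indicator (- ball x 1) y * ennreal (norm (x - y) powr - a) \<partial>lborel) \<le> ennreal C0"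
    using nn_integral_norm_powr_far_bounded[where 'a='a] a unfolding N_def by blast
  have M0: "M \<ge> 0" using M[of undefined] by linarith
  define C where "C = L powr q * unit_ball_vol N + (2 * M) powr q * C0"
  show thesis
  proof (rule that[of C q])
    show "0 \<le> C" using C0 N by (simp add: C_def)
    fix p x
    assume p: "q + 1 \<le> p" and h: "\<And>y. \<phi> x - \<phi> y \<le> b * norm (x - y) powr \<sigma>"
    have pw: "ennreal (max 0 (\<phi> x - \<phi> y) powr (p - 1) / norm (x - y) powr (N + \<sigma> * p))
      \<le> ennreal (b powr (p - 1 - q)) * (ennreal (L powr q) * indicator (ball x 1) y
           + ennreal ((2 * M) powr q) * (indicator (- ball x 1) y * ennreal (norm (x - y) powr - a)))"
      (is "?l \<le> ?r") for y
    proof (cases "\<phi> x - \<phi> y > 0")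
      case False
      then show ?thesis using p q by (simp add: max_def)
    next
      case True
      define d where "d = \<phi> x - \<phi> y"
      define r where "r = norm (x - y)"
      have d: "d > 0" using True by (simp add: d_def)
      have r: "r > 0" using True by (auto simp: r_def)
      have "d powr (p - 1) = d powr (p - 1 - q) * d powr q"
        by (simp add: powr_add[symmetric])
      also have "d powr (p - 1 - q) \<le> (b * r powr \<sigma>) powr (p - 1 - q)"
        using h[of y] d p by (intro powr_mono2) (auto simp: d_def r_def)
      also have "\<dots> = b powr (p - 1 - q) * r powr (\<sigma> * (p - 1 - q))"
        using assms r by (simp add: powr_mult powr_powr)
      finally have "d powr (p - 1) / r powr (N + \<sigma> * p)
          \<le> b powr (p - 1 - q) * r powr (\<sigma> * (p - 1 - q)) * d powr q / r powr (N + \<sigma> * p)"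
        by (simp add: divide_right_mono mult_right_mono)
      also have "\<dots> = b powr (p - 1 - q) * d powr q * (r powr (\<sigma> * (p - 1 - q)) / r powr (N + \<sigma> * p))"
        by simp
      also have "r powr (\<sigma> * (p - 1 - q)) / r powr (N + \<sigma> * p) = r powr (- a)"
        using r by (simp add: powr_diff[symmetric] a_def algebra_simps)
      finally have 1: "d powr (p - 1) / r powr (N + \<sigma> * p) \<le> b powr (p - 1 - q) * (d powr q * r powr (- a))"
        by (simp add: mult.assoc)
      have near: "d powr q * r powr (- a) \<le> L powr q"
      proof -
        have "d powr q \<le> (L * r) powr q"
          using lip[of x y] d q by (intro powr_mono2) (auto simp: d_def r_def)
        also have "\<dots> = L powr q * r powr q" using assms r by (simp add: powr_mult)
        finally have "d powr q * r powr (- a) \<le> L powr q * r powr q * r powr (- a)"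
          by (simp add: mult_right_mono)
        also have "\<dots> = L powr q" using r a by (simp add: powr_add[symmetric] mult.assoc)
        finally show ?thesis .
      qed
      have far: "d powr q * r powr (- a) \<le> (2 * M) powr q * r powr (- a)"
        using M[of x] M[of y] d q by (intro mult_right_mono powr_mono2) (auto simp: d_def)
      have "?l = ennreal (d powr (p - 1) / r powr (N + \<sigma> * p))"
        using True by (simp add: d_def r_def)
      also have "\<dots> \<le> ennreal (b powr (p - 1 - q) * (d powr q * r powr (- a)))"
        by (intro ennreal_leI 1)
      also have "\<dots> = ennreal (b powr (p - 1 - q)) * ennreal (d powr q * r powr (- a))"
        by (simp add: ennreal_mult)
      also have "\<dots> \<le> ?r"
      proof (intro mult_left_mono)
        show "ennreal (d powr q * r powr - a)
          \<le> ennreal (L powr q) * indicator (ball x 1) y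
           + ennreal ((2 * M) powr q) * (indicator (- ball x 1) y * ennreal (norm (x - y) powr - a))"
          using near far by (cases "y \<in> ball x 1") (auto simp: r_def ennreal_mult[symmetric] intro!: ennreal_leI)
      qed simp
      finally show ?thesis .
    qed
    let ?near = "\<lambda>y. ennreal (L powr q) * indicator (ball x 1) y"
    let ?far = "\<lambda>y. indicator (- ball x 1) y * ennreal (norm (x - y) powr - a)"
    have near_meas: "?near \<in> borel_measurable lborel"
      by (intro borel_measurable_times_ennreal borel_measurable_const borel_measurable_indicator) simp
    have "(\<lambda>y. norm (x - y) powr - a) \<in> borel_measurable lborel"
      by measurable
    then have far_meas: "?far \<in> borel_measurable lborel"
      by (intro borel_measurable_times_ennreal borel_measurable_indicator measurable_compose[OF _ measurable_ennreal])
        (simp_all add: borel_comp)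
    have cfar_meas: "(\<lambda>y. ennreal ((2 * M) powr q) * ?far y) \<in> borel_measurable lborel"
      by (intro borel_measurable_times_ennreal borel_measurable_const far_meas)
    have "one_sided_op \<sigma> p \<phi> x \<le> (\<integral>\<^sup>+ y. ennreal (b powr (p - 1 - q)) * (ennreal (L powr q) * indicator (ball x 1) y
           + ennreal ((2 * M) powr q) * (indicator (- ball x 1) y * ennreal (norm (x - y) powr - a))) \<partial>lborel)"
      unfolding one_sided_op_def N_def[symmetric] by (intro nn_integral_mono pw)
    also have "\<dots> = ennreal (b powr (p - 1 - q)) * (ennreal (L powr q) * emeasure lborel (ball x 1)
           + ennreal ((2 * M) powr q) * (\<integral>\<^sup>+ y. indicator (- ball x 1) y * ennreal (norm (x - y) powr - a) \<partial>lborel))"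
      by (simp add: nn_integral_cmult[OF borel_measurable_add[OF near_meas cfar_meas]]
          nn_integral_add[OF near_meas cfar_meas] nn_integral_cmult[OF far_meas] nn_integral_cmult_indicator)
    also have "\<dots> \<le> ennreal (b powr (p - 1 - q)) * (ennreal (L powr q) * ennreal (unit_ball_vol N)
           + ennreal ((2 * M) powr q) * ennreal C0)"
      by (intro mult_left_mono add_mono C0) (auto simp: emeasure_ball N_def)
    also have "\<dots> = ennreal (b powr (p - 1 - q) * C)"
      using C0 N by (simp add: C_def ennreal_mult)
    finally show "one_sided_op \<sigma> p \<phi> x \<le> ennreal (b powr (p - 1 - q) * C)" .
  qed
qed

text \<open>Only the ball around \<open>y0\<close> is kept in the integral. There the Hoelder factor
  and the kernel combine to |x - y|^(-(N + \<sigma>)), an exponent free of p, which is at least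
  D^(-(N + \<sigma>)). Hence the growth in p is that of a^(p-1).\<close>

lemma one_sided_op_lower:
  fixes \<phi> :: "'a::euclidean_space \<Rightarrow> real"
  assumes "0 < \<sigma>" "0 < a" "0 < \<rho>" "1 < p"
    and h: "\<And>y. y \<in> ball y0 \<rho> \<Longrightarrow> a * norm (x - y) powr \<sigma> \<le> \<phi> x - \<phi> y"
    and D: "\<And>y. y \<in> ball y0 \<rho> \<Longrightarrow> x \<noteq> y \<and> norm (x - y) \<le> D"
  shows "ennreal (a powr (p - 1) * (D powr (- (real DIM('a) + \<sigma>)) * measure lborel (ball y0 \<rho>)))
    \<le> one_sided_op \<sigma> p \<phi> x"
proof -
  define N where "N = real DIM('a)"
  have pw: "ennreal (a powr (p - 1) * D powr (- (N + \<sigma>))) * indicator (ball y0 \<rho>) y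
     \<le> ennreal (max 0 (\<phi> x - \<phi> y) powr (p - 1) / norm (x - y) powr (N + \<sigma> * p))" for y
  proof (cases "y \<in> ball y0 \<rho>")
    case True
    define r where "r = norm (x - y)"
    have r: "0 < r" "r \<le> D" using D[OF True] by (auto simp: r_def)
    have "a powr (p - 1) * D powr (- (N + \<sigma>)) \<le> a powr (p - 1) * r powr (- (N + \<sigma>))"
      using r assms by (intro mult_left_mono powr_mono2') (auto simp: N_def)
    also have "\<dots> = a powr (p - 1) * (r powr (\<sigma> * (p - 1)) / r powr (N + \<sigma> * p))"
      using r by (simp add: powr_diff[symmetric] algebra_simps)
    also have "\<dots> = (a * r powr \<sigma>) powr (p - 1) / r powr (N + \<sigma> * p)"
      using r assms by (simp add: powr_mult powr_powr)
    also have "\<dots> \<le> max 0 (\<phi> x - \<phi> y) powr (p - 1) / r powr (N + \<sigma> * p)"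
      using h[OF True] assms r by (intro divide_right_mono powr_mono2) (auto simp: r_def)
    finally show ?thesis using True by (auto simp: r_def intro!: ennreal_leI)
  qed simp
  have "ennreal (a powr (p - 1) * (D powr (- (real DIM('a) + \<sigma>)) * measure lborel (ball y0 \<rho>)))
     = ennreal (a powr (p - 1) * D powr (- (N + \<sigma>))) * emeasure lborel (ball y0 \<rho>)"
    using emeasure_lborel_ball_finite[of y0 \<rho>]
    by (subst emeasure_eq_ennreal_measure) (auto simp: N_def ennreal_mult[symmetric] mult.assoc)
  also have "\<dots> = (\<integral>\<^sup>+ y. ennreal (a powr (p - 1) * D powr (- (N + \<sigma>))) * indicator (ball y0 \<rho>) y \<partial>lborel)"
    by (rule nn_integral_cmult_indicator[symmetric]) simp
  also have "\<dots> \<le> one_sided_op \<sigma> p \<phi> x"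
    unfolding one_sided_op_def N_def[symmetric] by (intro nn_integral_mono pw)
  finally show ?thesis .
qed

section \<open>Lipschitz bounds for test functions and their Hoelder quotients\<close>

lemma C1_compact_support_lipschitz_bounded:
  fixes \<phi> :: "'a::euclidean_space \<Rightarrow> real"
  assumes "\<phi> \<in> C1_compact_support"
  obtains L M where "0 \<le> L" "\<And>x y. \<bar>\<phi> x - \<phi> y\<bar> \<le> L * norm (x - y)" "\<And>x. \<bar>\<phi> x\<bar> \<le> M"
proof -
  define S where "S = closure {x. \<phi> x \<noteq> 0}"
  define \<phi>' where "\<phi>' x = frechet_derivative \<phi> (at x)" for x
  have S: "compact S" and diff: "\<And>x. \<phi> differentiable (at x)"
    and cont: "\<And>e. continuous_on UNIV (\<lambda>x. \<phi>' x e)"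
    using assms by (auto simp: C1_compact_support_def S_def \<phi>'_def)
  have der: "(\<phi> has_derivative \<phi>' x) (at x)" for x
    using diff frechet_derivative_works unfolding \<phi>'_def by blast
  have out0: "\<phi> x = 0" if "x \<notin> S" for x
    using that closure_subset[of "{x. \<phi> x \<noteq> 0}"] by (auto simp: S_def)
  have out: "\<phi>' x = (\<lambda>h. 0)" if "x \<notin> S" for x
  proof -
    have "((\<lambda>x. 0) has_derivative (\<lambda>h. 0)) (at x)" by simp
    then have "(\<phi> has_derivative (\<lambda>h. 0)) (at x)"
      by (rule has_derivative_transform_within_open[of _ _ _ _ "- S"])
        (use that out0 S in \<open>auto simp: compact_imp_closed\<close>)
    then show ?thesis using der has_derivative_unique by blast
  qed
  \<comment> \<open>Each directional derivative is continuous, hence bounded on the compact support,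
    and it vanishes elsewhere.\<close>
  have "\<exists>B. \<forall>x. \<bar>\<phi>' x e\<bar> \<le> B \<and> 0 \<le> B" for e
  proof -
    have "bounded ((\<lambda>x. \<phi>' x e) ` S)"
      by (intro compact_imp_bounded compact_continuous_image continuous_on_subset[OF cont] S) auto
    then obtain B where "\<And>x. x \<in> S \<Longrightarrow> \<bar>\<phi>' x e\<bar> \<le> B" "B > 0"
      unfolding bounded_pos by auto
    then show ?thesis
      by (intro exI[of _ B] allI) (metis abs_zero less_imp_le out)
  qed
  then obtain B where B: "\<And>e x. \<bar>\<phi>' x e\<bar> \<le> B e" "\<And>e. 0 \<le> B e" by metis
  \<comment> \<open>Each coordinate of \<open>h\<close> is at most \<open>norm h\<close>, so the
    bounds in the basis directions add up to a bound on the operator norm; the mean value inequality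
    then makes it a Lipschitz constant.\<close>
  define L where "L = (\<Sum>e\<in>Basis. B e)"
  have on: "onorm (\<phi>' x) \<le> L" for x
  proof (rule onorm_bound)
    show "0 \<le> L" by (simp add: L_def B sum_nonneg)
    fix h :: 'a
    have lin: "linear (\<phi>' x)" using der has_derivative_linear by blast
    have "\<phi>' x h = \<phi>' x (\<Sum>e\<in>Basis. (h \<bullet> e) *\<^sub>R e)" by (simp add: euclidean_representation)
    also have "\<dots> = (\<Sum>e\<in>Basis. (h \<bullet> e) * \<phi>' x e)"
      by (simp add: linear_sum[OF lin] linear_cmul[OF lin])
    finally have "\<bar>\<phi>' x h\<bar> \<le> (\<Sum>e\<in>Basis. \<bar>(h \<bullet> e) * \<phi>' x e\<bar>)"
      by (simp add: sum_abs)
    also have "\<dots> \<le> (\<Sum>e\<in>Basis. norm h * B e)"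
      by (intro sum_mono) (auto simp: abs_mult intro!: mult_mono B Basis_le_norm)
    also have "\<dots> = L * norm h" by (simp add: L_def sum_distrib_left mult.commute)
    finally show "norm (\<phi>' x h) \<le> L * norm h" by simp
  qed
  have L0: "0 \<le> L" by (simp add: L_def B sum_nonneg)
  have lip: "\<bar>\<phi> x - \<phi> y\<bar> \<le> L * norm (x - y)" for x y
    using differentiable_bound[of UNIV \<phi> \<phi>' L x y] der on by simp
  have "continuous_on S \<phi>"
    using der by (meson has_derivative_continuous continuous_at_imp_continuous_on)
  then have "bounded (\<phi> ` S)" using S compact_continuous_image compact_imp_bounded by blast
  then obtain M where "M > 0" "\<And>x. x \<in> S \<Longrightarrow> \<bar>\<phi> x\<bar> \<le> M" unfolding bounded_pos by auto
  then have "\<bar>\<phi> x\<bar> \<le> M" for x using out0[of x] by (cases "x \<in> S") auto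
  then show thesis using that L0 lip by blast
qed

text \<open>One factor x + y is split off the power; since \<sigma> - 1 \<le> 0, the remaining power
  only grows when x + y is replaced by x or by y.\<close>

lemma powr_add_le:
  fixes x y \<sigma> :: real
  assumes "0 \<le> x" "0 \<le> y" "0 < \<sigma>" "\<sigma> \<le> 1"
  shows "(x + y) powr \<sigma> \<le> x powr \<sigma> + y powr \<sigma>"
proof (cases "x = 0 \<or> y = 0")
  case False
  then have xy: "x > 0" "y > 0" using assms by auto
  have split: "c * c powr (\<sigma> - 1) = c powr \<sigma>" if "c > 0" for c
    using that powr_mult_base[of c "\<sigma> - 1"] by simp
  have "(x + y) powr \<sigma> = x * (x + y) powr (\<sigma> - 1) + y * (x + y) powr (\<sigma> - 1)"
    using split[of "x + y"] xy by (simp add: distrib_right)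
  also have "\<dots> \<le> x * x powr (\<sigma> - 1) + y * y powr (\<sigma> - 1)"
    using xy assms by (intro add_mono mult_left_mono powr_mono2') auto
  finally show ?thesis using split xy by simp
qed auto

text \<open>This makes the real \<open>SUP\<close> and \<open>INF\<close> in \<open>L_inf\<close>
  genuine bounds. Up to distance 1 the Lipschitz bound suffices because r \<le> r^\<sigma>; beyond
  it the bound \<open>2 * M\<close> on increments does.\<close>

lemma holder_quotient_bounded:
  fixes \<phi> :: "'a::euclidean_space \<Rightarrow> real"
  assumes \<sigma>: "0 < \<sigma>" "\<sigma> < 1" and "0 \<le> L"
    and lip: "\<And>x y. \<bar>\<phi> x - \<phi> y\<bar> \<le> L * norm (x - y)" and M: "\<And>x. \<bar>\<phi> x\<bar> \<le> M"
  shows "bdd_above ((\<lambda>y. (\<phi> y - \<phi> x) / norm (y - x) powr \<sigma>) ` (UNIV - {x}))"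
    and "bdd_below ((\<lambda>y. (\<phi> y - \<phi> x) / norm (y - x) powr \<sigma>) ` (UNIV - {x}))"
proof -
  have M0: "M \<ge> 0" using M[of undefined] by linarith
  have bnd: "\<bar>(\<phi> y - \<phi> x) / norm (y - x) powr \<sigma>\<bar> \<le> L + 2 * M" if "y \<noteq> x" for y
  proof -
    define r where "r = norm (y - x)"
    have r: "r > 0" using that by (simp add: r_def)
    have "\<bar>\<phi> y - \<phi> x\<bar> \<le> (L + 2 * M) * r powr \<sigma>"
    proof (cases "r \<le> 1")
      case True
      have "r \<le> r powr \<sigma>" using r True \<sigma> powr_mono'[of \<sigma> 1 r] by simp
      then have "L * r \<le> L * r powr \<sigma>" using assms by (intro mult_left_mono)
      moreover have "0 \<le> 2 * M * r powr \<sigma>" using M0 by simp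
      ultimately show ?thesis using lip[of y x] by (simp add: r_def distrib_right)
    next
      case False
      then have "1 \<le> r powr \<sigma>" using \<sigma> by (simp add: ge_one_powr_ge_zero)
      then have "2 * M \<le> 2 * M * r powr \<sigma>" using M0 mult_left_mono[of 1 "r powr \<sigma>" "2 * M"] by simp
      moreover have "0 \<le> L * r powr \<sigma>" using assms by simp
      ultimately show ?thesis using M[of x] M[of y] by (simp add: distrib_right)
    qed
    then show ?thesis using r by (simp add: r_def[symmetric] divide_le_eq)
  qed
  show "bdd_above ((\<lambda>y. (\<phi> y - \<phi> x) / norm (y - x) powr \<sigma>) ` (UNIV - {x}))"
  proof (rule bdd_aboveI2[of _ _ "L + 2 * M"])
    fix y assume "y \<in> UNIV - {x}"
    then show "(\<phi> y - \<phi> x) / norm (y - x) powr \<sigma> \<le> L + 2 * M"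
      using bnd[of y] unfolding abs_le_iff by auto
  qed
  show "bdd_below ((\<lambda>y. (\<phi> y - \<phi> x) / norm (y - x) powr \<sigma>) ` (UNIV - {x}))"
  proof (rule bdd_belowI2[of _ "- (L + 2 * M)"])
    fix y assume "y \<in> UNIV - {x}"
    then show "- (L + 2 * M) \<le> (\<phi> y - \<phi> x) / norm (y - x) powr \<sigma>"
      using bnd[of y] unfolding abs_le_iff by auto
  qed
qed

text \<open>Raising \<open>m\<close> to \<open>b\<close> pays for moving the base point from
  \<open>z\<close> to \<open>x\<close>. For |x - y| \<le> \<delta> the Lipschitz bound alone is
  below b |x - y|^\<sigma>. For larger distances the move costs at most m \<rho>^\<sigma> + L
  \<rho>, which the slack (b - m) \<delta>^\<sigma> absorbs.\<close>

lemma one_sided_holder_bound_nearby: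
  fixes \<phi> :: "'a::euclidean_space \<Rightarrow> real"
  assumes \<sigma>: "0 < \<sigma>" "\<sigma> < 1" and L: "0 \<le> L"
    and lip: "\<And>x y. \<bar>\<phi> x - \<phi> y\<bar> \<le> L * norm (x - y)"
    and m: "0 \<le> m" "m < b" and h: "\<And>y. \<phi> z - \<phi> y \<le> m * norm (z - y) powr \<sigma>"
  obtains \<rho> where "0 < \<rho>" "\<And>x y. x \<in> ball z \<rho> \<Longrightarrow> \<phi> x - \<phi> y \<le> b * norm (x - y) powr \<sigma>"
proof -
  \<comment> \<open>Chosen so that L \<delta>^(1-\<sigma>) \<le> b; the summand 1 avoids a division
    by zero.\<close>
  define \<delta> where "\<delta> = (b / (L + 1)) powr (1 / (1 - \<sigma>))"
  have b: "b > 0" using m by simp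
  have \<delta>0: "\<delta> > 0" using b L by (simp add: \<delta>_def)
  have "L * \<delta> powr (1 - \<sigma>) = b * (L / (L + 1))" using b L \<sigma> by (simp add: \<delta>_def powr_powr)
  also have "\<dots> \<le> b * 1" using b L by (intro mult_left_mono) auto
  finally have \<delta>: "L * \<delta> powr (1 - \<sigma>) \<le> b" by simp
  \<comment> \<open>The cost of moving the base point tends to 0 with \<rho>, as
    \<open>0 powr \<sigma>\<close> is 0, so it falls below the slack.\<close>
  have lim: "((\<lambda>\<rho>. m * \<rho> powr \<sigma> + L * \<rho>) \<longlongrightarrow> m * 0 powr \<sigma> + L * 0) (at_right 0)"
    using \<sigma> by (intro tendsto_intros tendsto_powr') (auto simp: eventually_at_filter)
  have "m * 0 powr \<sigma> + L * 0 < (b - m) * \<delta> powr \<sigma>" using m \<delta>0 by simp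
  from order_tendstoD(2)[OF lim this] obtain d where d: "d > 0" "\<And>\<rho>. 0 < \<rho> \<Longrightarrow> \<rho> < d \<Longrightarrow> m * \<rho> powr \<sigma> + L * \<rho> < (b - m) * \<delta> powr \<sigma>"
    by (auto simp: eventually_at_right_field)
  define \<rho> where "\<rho> = d / 2"
  have \<rho>: "0 < \<rho>" "m * \<rho> powr \<sigma> + L * \<rho> < (b - m) * \<delta> powr \<sigma>"
    using d(1) d(2)[of "d / 2"] unfolding \<rho>_def by simp_all
  show thesis
  proof (rule that[OF \<rho>(1)])
    fix x y assume x: "x \<in> ball z \<rho>"
    define r where "r = norm (x - y)"
    have r0: "r \<ge> 0" by (simp add: r_def)
    show "\<phi> x - \<phi> y \<le> b * norm (x - y) powr \<sigma>"
    proof (cases "r \<le> \<delta>")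
      case True
      have "r = r powr (1 - \<sigma>) * r powr \<sigma>" using r0 by (cases "r = 0") (auto simp: powr_add[symmetric])
      then have "L * r = L * r powr (1 - \<sigma>) * r powr \<sigma>" by (metis mult.assoc)
      also have "\<dots> \<le> L * \<delta> powr (1 - \<sigma>) * r powr \<sigma>"
        using L r0 \<sigma> True by (intro mult_right_mono mult_left_mono powr_mono2) auto
      also have "\<dots> \<le> b * r powr \<sigma>" using \<delta> by (intro mult_right_mono) auto
      finally show ?thesis using lip[of x y] by (simp add: r_def)
    next
      case False
      have nx: "norm (x - z) < \<rho>" using x by (simp add: dist_norm norm_minus_commute)
      have "norm (z - y) \<le> r + \<rho>"
        using norm_triangle_ineq[of "z - x" "x - y"] nx by (simp add: r_def norm_minus_commute)
      then have "norm (z - y) powr \<sigma> \<le> (r + \<rho>) powr \<sigma>" using \<sigma> by (intro powr_mono2) auto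
      also have "\<dots> \<le> r powr \<sigma> + \<rho> powr \<sigma>" using r0 \<rho> \<sigma> by (intro powr_add_le) auto
      finally have "m * norm (z - y) powr \<sigma> \<le> m * (r powr \<sigma> + \<rho> powr \<sigma>)" using m by (intro mult_left_mono)
      moreover have "\<phi> x - \<phi> z \<le> L * \<rho>"
      proof -
        have "\<phi> x - \<phi> z \<le> L * norm (x - z)" using lip[of x z] by linarith
        also have "\<dots> \<le> L * \<rho>" using L nx by (intro mult_left_mono) auto
        finally show ?thesis .
      qed
      moreover have "(b - m) * \<delta> powr \<sigma> \<le> (b - m) * r powr \<sigma>"
        using False \<delta>0 m \<sigma> by (intro mult_left_mono powr_mono2) auto
      ultimately show ?thesis using h[of y] \<rho> by (simp add: r_def algebra_simps)
    qed
  qed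
qed

section \<open>The exponential gap between the two one-sided operators\<close>

lemma lipschitz_imp_continuous:
  fixes \<phi> :: "'a::euclidean_space \<Rightarrow> real"
  assumes "0 \<le> L" "\<And>x y. \<bar>\<phi> x - \<phi> y\<bar> \<le> L * norm (x - y)"
  shows "continuous_on UNIV \<phi>"
  using assms by (intro lipschitz_on_continuous_on[of L]) (auto simp: lipschitz_on_def dist_norm)

text \<open>The ratio of the two powers is a constant times exp(l (p - 1)) with l = ln b - ln a < 0;
  its decay beats the fixed factors.\<close>

lemma eventually_powr_less_powr:
  fixes a b q C c :: real
  assumes "0 < b" "b < a" "0 < c"
  shows "eventually (\<lambda>p. b powr (p - 1 - q) * C < a powr (p - 1) * c) at_top"
proof -
  define l where "l = ln b - ln a"
  have l: "l < 0" using assms by (simp add: l_def)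
  have "filterlim (\<lambda>p. l * (p - 1)) at_bot at_top"
    by (intro filterlim_tendsto_neg_mult_at_bot[OF tendsto_const l] filterlim_tendsto_add_at_top[of "\<lambda>_. -1", OF tendsto_const filterlim_ident, simplified])
  then have "((\<lambda>p. exp (l * (p - 1))) \<longlongrightarrow> 0) at_top"
    by (rule filterlim_compose[OF exp_at_bot])
  then have "((\<lambda>p. b powr (- q) * C * exp (l * (p - 1))) \<longlongrightarrow> b powr (- q) * C * 0) at_top"
    by (intro tendsto_intros)
  then have "eventually (\<lambda>p. b powr (- q) * C * exp (l * (p - 1)) < c) at_top"
    using assms by (intro order_tendstoD(2)) auto
  then show ?thesis
  proof eventually_elim
    case (elim p)
    have "b powr (p - 1 - q) = b powr (- q) * (exp (l * (p - 1)) * a powr (p - 1))"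
      using assms by (simp add: powr_def l_def exp_add[symmetric] algebra_simps)
    then have "b powr (p - 1 - q) * C = (b powr (- q) * C * exp (l * (p - 1))) * a powr (p - 1)"
      by simp
    also have "\<dots> < c * a powr (p - 1)" using elim assms by (intro mult_strict_right_mono) auto
    finally show ?case by (simp add: mult.commute)
  qed
qed

text \<open>Positivity of A + I says that the steepest ascent from \<open>z\<close> exceeds the
  steepest descent. A rate \<open>b\<close> above the descent bounds one operator near
  \<open>z\<close>, and a rate \<open>a > b\<close> below the ascent, realised near some
  \<open>y0\<close>, bounds the other from below; large p separates the two.\<close>

lemma one_sided_op_gap:
  fixes \<phi> :: "'a::euclidean_space \<Rightarrow> real"
  assumes \<sigma>: "0 < \<sigma>" "\<sigma> < 1" and L: "0 \<le> L"
    and lip: "\<And>x y. \<bar>\<phi> x - \<phi> y\<bar> \<le> L * norm (x - y)" and M: "\<And>x. \<bar>\<phi> x\<bar> \<le> M"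
    and pos: "0 < L_inf \<sigma> \<phi> z"
  obtains \<rho> where "0 < \<rho>"
    "eventually (\<lambda>p. \<exists>C1 C2. 0 \<le> C1 \<and> C1 < C2 \<and> (\<forall>x\<in>ball z \<rho>.
        one_sided_op \<sigma> p \<phi> x \<le> ennreal C1 \<and> ennreal C2 \<le> one_sided_op \<sigma> p (\<lambda>y. - \<phi> y) x)) at_top"
proof -
  let ?g = "\<lambda>y. (\<phi> y - \<phi> z) / norm (y - z) powr \<sigma>"
  define A where "A = (SUP y\<in>UNIV - {z}. ?g y)"
  define I where "I = (INF y\<in>UNIV - {z}. ?g y)"
  note bdd = holder_quotient_bounded[OF \<sigma> L lip M, of z]
  \<comment> \<open>A basis vector supplies a point other than \<open>z\<close>, so that the
    supremum and infimum range over a nonempty set.\<close>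
  obtain e :: 'a where "e \<in> Basis" using nonempty_Basis by blast
  then have "z + e \<in> UNIV - {z}" by (auto simp: nonzero_Basis)
  then have ne: "UNIV - {z} \<noteq> {}" by blast
  have "I \<le> ?g (z + e)" "?g (z + e) \<le> A"
    unfolding A_def I_def by (intro cINF_lower cSUP_upper bdd \<open>z + e \<in> UNIV - {z}\<close>)+
  then have "I \<le> A" by simp
  moreover have AI: "A + I > 0" using pos by (simp add: L_inf_def A_def I_def)
  ultimately have A0: "A > 0" by simp
  \<comment> \<open>The descent rate is cut off at 0, because \<open>I\<close> may be positive and
    the transfer to nearby points asks for a nonnegative rate.\<close>
  define m where "m = max 0 (- I)"
  have m: "0 \<le> m" "m < A" using AI A0 by (auto simp: m_def)
  have hz: "\<phi> z - \<phi> y \<le> m * norm (z - y) powr \<sigma>" for y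
  proof (cases "y = z")
    case False
    then have "I \<le> ?g y" unfolding I_def by (intro cINF_lower bdd) auto
    then have "- m \<le> ?g y" by (simp add: m_def)
    then show ?thesis using False by (simp add: le_divide_eq norm_minus_commute)
  qed simp
  \<comment> \<open>The points \<open>b\<close> and \<open>a\<close> divide the interval from
    \<open>m\<close> to \<open>A\<close> into thirds: \<open>m < b\<close> leaves room to move the
    base point, \<open>b < a\<close> yields the gap, and \<open>a < A\<close> is exceeded by the
    quotient at some \<open>y0\<close>.\<close>
  define b where "b = m + (A - m) / 3"
  define a where "a = m + 2 * (A - m) / 3"
  have ab: "0 < b" "m < b" "b < a" "a < A" using m by (auto simp: a_def b_def field_simps)
  obtain y0 where y0: "y0 \<noteq> z" "a < ?g y0"
    using less_cSUP_iff[OF ne bdd(1), of a] ab(4) by (auto simp: A_def)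
  obtain \<rho>1 where \<rho>1: "0 < \<rho>1" "\<And>x y. x \<in> ball z \<rho>1 \<Longrightarrow> \<phi> x - \<phi> y \<le> b * norm (x - y) powr \<sigma>"
    using one_sided_holder_bound_nearby[OF \<sigma> L lip m(1) ab(2) hz] by blast
  \<comment> \<open>The strict inequality at \<open>(z, y0)\<close> persists on a product
    neighbourhood, so one ball around \<open>y0\<close> serves all \<open>x\<close> near
    \<open>z\<close>.\<close>
  define G where "G = {(x, y). a * norm (x - y) powr \<sigma> < \<phi> y - \<phi> x}"
  have cont: "continuous_on UNIV \<phi>" using L lip by (rule lipschitz_imp_continuous)
  have "open G"
    unfolding G_def case_prod_beta
    by (intro open_Collect_less continuous_intros continuous_on_compose2[OF cont] continuous_on_powr')
      (use \<sigma> in auto)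
  moreover have "(z, y0) \<in> G"
    using y0 by (simp add: G_def less_divide_eq norm_minus_commute)
  ultimately obtain U V where UV: "open U" "open V" "z \<in> U" "y0 \<in> V" "U \<times> V \<subseteq> G"
    by (auto elim: open_prod_elim)
  obtain \<rho>2 \<rho>3 where \<rho>23: "\<rho>2 > 0" "ball z \<rho>2 \<subseteq> U" "\<rho>3 > 0" "ball y0 \<rho>3 \<subseteq> V"
    using UV by (metis openE)
  define \<rho> where "\<rho> = min \<rho>1 \<rho>2"
  define D where "D = \<rho>2 + norm (z - y0) + \<rho>3"
  have D0: "D > 0" using \<rho>23 by (simp add: D_def add_pos_nonneg add_nonneg_pos)
  have in_G: "a * norm (x - y) powr \<sigma> < \<phi> y - \<phi> x" if "x \<in> ball z \<rho>" "y \<in> ball y0 \<rho>3" for x y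
  proof -
    have "x \<in> U" "y \<in> V" using that \<rho>23 by (auto simp: \<rho>_def subset_iff)
    then have "(x, y) \<in> G" using UV by blast
    then show ?thesis by (simp add: G_def)
  qed
  have in_D: "x \<noteq> y \<and> norm (x - y) \<le> D" if "x \<in> ball z \<rho>" "y \<in> ball y0 \<rho>3" for x y
  proof
    \<comment> \<open>On the diagonal the strict inequality defining \<open>G\<close> would read 0 <
      0.\<close>
    show "x \<noteq> y" using in_G[OF that] by auto
    have "norm (x - y) \<le> norm (x - z) + norm (z - y0) + norm (y0 - y)"
      by norm
    then show "norm (x - y) \<le> D" using that by (simp add: D_def \<rho>_def dist_norm norm_minus_commute)
  qed
  obtain C q where C: "0 \<le> C" "\<And>p x. q + 1 \<le> p \<Longrightarrow>
      (\<And>y. \<phi> x - \<phi> y \<le> b * norm (x - y) powr \<sigma>) \<Longrightarrow>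
      one_sided_op \<sigma> p \<phi> x \<le> ennreal (b powr (p - 1 - q) * C)"
    using one_sided_op_upper[OF \<sigma> L ab(1) lip M] by blast
  define c where "c = D powr (- (real DIM('a) + \<sigma>)) * measure lborel (ball y0 \<rho>3)"
  have c: "c > 0" using D0 \<rho>23 by (simp add: c_def content_ball_pos)
  have ev: "eventually (\<lambda>p. \<exists>C1 C2. 0 \<le> C1 \<and> C1 < C2 \<and> (\<forall>x\<in>ball z \<rho>.
        one_sided_op \<sigma> p \<phi> x \<le> ennreal C1 \<and> ennreal C2 \<le> one_sided_op \<sigma> p (\<lambda>y. - \<phi> y) x)) at_top"
    using eventually_powr_less_powr[OF ab(1,3) c, of q C] eventually_ge_at_top[of "q + 1"] eventually_gt_at_top[of 1]
  proof eventually_elim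
    case (elim p)
    show ?case
    proof (rule exI[of _ "b powr (p - 1 - q) * C"], rule exI[of _ "a powr (p - 1) * c"], intro conjI ballI)
      fix x assume x: "x \<in> ball z \<rho>"
      then show "one_sided_op \<sigma> p \<phi> x \<le> ennreal (b powr (p - 1 - q) * C)"
        using elim \<rho>1 by (intro C) (auto simp: \<rho>_def)
      show "ennreal (a powr (p - 1) * c) \<le> one_sided_op \<sigma> p (\<lambda>y. - \<phi> y) x"
        unfolding c_def
      proof (rule one_sided_op_lower)
        show "a * norm (x - y) powr \<sigma> \<le> - \<phi> x - - \<phi> y" if "y \<in> ball y0 \<rho>3" for y
          using in_G[OF x that] by simp
        show "x \<noteq> y \<and> norm (x - y) \<le> D" if "y \<in> ball y0 \<rho>3" for y
          using in_D[OF x that] .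
      qed (use \<sigma> ab \<rho>23 elim in auto)
    qed (use elim C in auto)
  qed
  have "\<rho> > 0" using \<rho>1 \<rho>23 by (simp add: \<rho>_def)
  then show thesis using ev by (rule that)
qed

section \<open>Uniform limits of energy minimisers\<close>

text \<open>Competitors are constrained by their value at \<open>x0\<close> but not in sign, so the
  notion is stable under u -> -u. This carries the supersolution argument over to
  subsolutions.\<close>

definition energy_minimizer ::
  "real \<Rightarrow> real \<Rightarrow> 'a::euclidean_space set \<Rightarrow> 'a \<Rightarrow> ('a \<Rightarrow> real) \<Rightarrow> bool" where
  "energy_minimizer \<sigma> p \<Omega> x0 u \<longleftrightarrow>
     u \<in> W0 \<sigma> p \<Omega> \<and> continuous_on UNIV u \<and>
     (\<forall>w\<in>W0 \<sigma> p \<Omega>. continuous_on UNIV w \<longrightarrow> w x0 = u x0 \<longrightarrow>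
        gagliardo_pow \<sigma> p u \<le> gagliardo_pow \<sigma> p w)"

lemma gagliardo_pow_uminus [simp]: "gagliardo_pow \<sigma> p (\<lambda>x. - u x) = gagliardo_pow \<sigma> p u"
proof -
  have "\<bar>- u x - - u y\<bar> = \<bar>u x - u y\<bar>" for x y by simp
  then show ?thesis unfolding gagliardo_pow_def by (simp only:)
qed

lemma W0_uminus: "u \<in> W0 \<sigma> p \<Omega> \<Longrightarrow> (\<lambda>x. - u x) \<in> W0 \<sigma> p \<Omega>"
  by (auto simp: W0_def)

lemma energy_minimizer_uminus:
  assumes "energy_minimizer \<sigma> p \<Omega> x0 u"
  shows "energy_minimizer \<sigma> p \<Omega> x0 (\<lambda>x. - u x)"
  unfolding energy_minimizer_def
proof (intro conjI ballI impI)
  show "(\<lambda>x. - u x) \<in> W0 \<sigma> p \<Omega>" "continuous_on UNIV (\<lambda>x. - u x)"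
    using assms by (auto simp: energy_minimizer_def W0_uminus intro: continuous_on_minus)
  fix w assume w: "w \<in> W0 \<sigma> p \<Omega>" "continuous_on UNIV w" "w x0 = - u x0"
  then have "gagliardo_pow \<sigma> p u \<le> gagliardo_pow \<sigma> p (\<lambda>x. - w x)"
    using assms W0_uminus[OF w(1)] by (auto simp: energy_minimizer_def intro: continuous_on_minus)
  then show "gagliardo_pow \<sigma> p (\<lambda>x. - u x) \<le> gagliardo_pow \<sigma> p w" by simp
qed

section \<open>Lifts as competitors\<close>

lemma integrable_continuous_bounded_support:
  fixes f :: "'a::euclidean_space \<Rightarrow> real"
  assumes "continuous_on UNIV f" "bounded S" "\<And>x. x \<notin> S \<Longrightarrow> f x = 0"
  shows "integrable lborel f"
proof -
  have "integrable lborel (\<lambda>x. indicator (closure S) x *\<^sub>R f x)"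
    using assms by (intro borel_integrable_compact continuous_on_subset[OF assms(1)]) auto
  moreover have "(\<lambda>x. indicator (closure S) x *\<^sub>R f x) = f"
    using assms(3) closure_subset[of S] by (intro ext) (auto simp: indicator_def)
  ultimately show ?thesis by (simp only:)
qed

lemma nn_integral_continuous_pos:
  fixes f :: "'a::euclidean_space \<Rightarrow> real"
  assumes f: "continuous_on UNIV f" "\<And>x. 0 \<le> f x" and z: "0 < f z"
  shows "0 < (\<integral>\<^sup>+ x. ennreal (f x) \<partial>lborel)"
proof -
  have "open {x. f z / 2 < f x}"
    by (intro open_Collect_less f continuous_intros)
  then obtain r where r: "r > 0" "ball z r \<subseteq> {x. f z / 2 < f x}"
    using z by (metis (mono_tags, lifting) mem_Collect_eq half_gt_zero_iff openE field_sum_of_halves less_add_same_cancel1)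
  have "0 < ennreal (f z / 2) * emeasure lborel (ball z r)"
    using r z by (simp add: ennreal_zero_less_mult_iff emeasure_ball)
  also have "\<dots> = (\<integral>\<^sup>+ x. ennreal (f z / 2) * indicator (ball z r) x \<partial>lborel)"
    by (rule nn_integral_cmult_indicator[symmetric]) simp
  also have "\<dots> \<le> (\<integral>\<^sup>+ x. ennreal (f x) \<partial>lborel)"
  proof (rule nn_integral_mono)
    fix x show "ennreal (f z / 2) * indicator (ball z r) x \<le> ennreal (f x)"
      using r(2) by (cases "x \<in> ball z r") (auto intro!: ennreal_leI)
  qed
  finally show ?thesis .
qed

text \<open>The lift alters \<open>u\<close> only inside a ball in \<Omega> that misses
  \<open>x0\<close>, so it is an admissible competitor. Minimality together with the energy estimate
  leaves C2 J \<le> C1 J with 0 < J < \<infinity>, against C1 < C2.\<close>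

lemma energy_minimizer_no_strict_lift:
  fixes u \<phi> :: "'a::euclidean_space \<Rightarrow> real"
  assumes min: "energy_minimizer \<sigma> p \<Omega> x0 u" and p: "1 < p" and \<Omega>: "bounded \<Omega>"
    and \<phi>: "continuous_on UNIV \<phi>"
    and sub: "ball z \<rho> \<subseteq> \<Omega> - {x0}"
    and out: "\<And>x. x \<notin> ball z \<rho> \<Longrightarrow> \<phi> x + c \<le> u x" and at: "u z < \<phi> z + c"
    and C: "0 \<le> C1" "C1 < C2"
    and op: "\<And>x. x \<in> ball z \<rho> \<Longrightarrow> one_sided_op \<sigma> p \<phi> x \<le> ennreal C1"
            "\<And>x. x \<in> ball z \<rho> \<Longrightarrow> ennreal C2 \<le> one_sided_op \<sigma> p (\<lambda>y. - \<phi> y) x"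
  shows False
proof -
  define \<eta> where "\<eta> x = max 0 (\<phi> x + c - u x)" for x
  define w where "w x = u x + \<eta> x" for x
  have u: "continuous_on UNIV u" "u \<in> W0 \<sigma> p \<Omega>" using min by (auto simp: energy_minimizer_def)
  have \<eta>: "continuous_on UNIV \<eta>" "\<And>x. 0 \<le> \<eta> x"
    unfolding \<eta>_def by (auto intro!: continuous_intros u \<phi>)
  have \<eta>_out: "\<eta> x = 0" if "x \<notin> ball z \<rho>" for x
    using out[OF that] by (simp add: \<eta>_def)
  have w_cont: "continuous_on UNIV w" unfolding w_def by (intro continuous_intros u \<eta>)
  have w_out: "w x = 0" if "x \<notin> \<Omega>" for x
  proof -
    have "u x = 0" using u(2) that by (simp add: W0_def)
    moreover have "x \<notin> ball z \<rho>" using sub that by blast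
    ultimately show ?thesis using \<eta>_out by (simp add: w_def)
  qed
  have "x0 \<notin> ball z \<rho>" using sub by blast
  then have w_x0: "w x0 = u x0" using \<eta>_out by (simp add: w_def)
  \<comment> \<open>The total mass of the lift, finite by bounded support and positive because
    \<eta> is continuous with \<eta> z > 0; hence it can be cancelled at the end.\<close>
  define J where "J = (\<integral>\<^sup>+ x. ennreal (p * \<eta> x) \<partial>lborel)"
  have p\<eta>: "continuous_on UNIV (\<lambda>x. p * \<eta> x)" by (intro continuous_intros \<eta>)
  then have p\<eta>_meas: "(\<lambda>x. ennreal (p * \<eta> x)) \<in> borel_measurable lborel"
    by (auto intro!: measurable_compose[OF borel_measurable_continuous_onI measurable_ennreal])
  have "integrable lborel (\<lambda>x. p * \<eta> x)"
    by (rule integrable_continuous_bounded_support[OF p\<eta>, of "ball z \<rho>"]) (auto simp: \<eta>_out)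
  then have "J < \<infinity>"
    using \<eta> p unfolding J_def by (subst nn_integral_eq_integral) auto
  moreover have "\<eta> z > 0" using at by (simp add: \<eta>_def)
  then have "0 < J" unfolding J_def using p \<eta> by (intro nn_integral_continuous_pos[OF p\<eta>, of z]) auto
  ultimately obtain j where j: "J = ennreal j" "0 < j"
    by (metis ennreal_cases ennreal_less_zero_iff infinity_ennreal_def less_irrefl ennreal_0 top.not_eq_extremum less_le)
  have upper: "(\<integral>\<^sup>+ x. ennreal (p * \<eta> x) * one_sided_op \<sigma> p \<phi> x \<partial>lborel) \<le> ennreal C1 * J"
  proof -
    have "ennreal (p * \<eta> x) * one_sided_op \<sigma> p \<phi> x \<le> ennreal C1 * ennreal (p * \<eta> x)" for x
      unfolding mult.commute[of "ennreal C1"]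
      using op(1)[of x] \<eta>_out[of x] by (cases "x \<in> ball z \<rho>") (auto intro!: mult_left_mono)
    then show ?thesis
      unfolding J_def nn_integral_cmult[OF p\<eta>_meas, symmetric] by (intro nn_integral_mono)
  qed
  have lower: "ennreal C2 * J \<le> (\<integral>\<^sup>+ x. ennreal (p * \<eta> x) * one_sided_op \<sigma> p (\<lambda>y. - \<phi> y) x \<partial>lborel)"
  proof -
    have "ennreal C2 * ennreal (p * \<eta> x) \<le> ennreal (p * \<eta> x) * one_sided_op \<sigma> p (\<lambda>y. - \<phi> y) x" for x
      unfolding mult.commute[of "ennreal C2"]
      using op(2)[of x] \<eta>_out[of x] by (cases "x \<in> ball z \<rho>") (auto intro!: mult_left_mono)
    then show ?thesis
      unfolding J_def nn_integral_cmult[OF p\<eta>_meas, symmetric] by (intro nn_integral_mono)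
  qed
  have "gagliardo_pow \<sigma> p w + 2 * (ennreal C2 * J)
      \<le> gagliardo_pow \<sigma> p w + 2 * (\<integral>\<^sup>+ x. ennreal (p * \<eta> x) * one_sided_op \<sigma> p (\<lambda>y. - \<phi> y) x \<partial>lborel)"
    by (intro add_left_mono mult_left_mono lower) simp
  also have "\<dots> \<le> gagliardo_pow \<sigma> p u + 2 * (\<integral>\<^sup>+ x. ennreal (p * \<eta> x) * one_sided_op \<sigma> p \<phi> x \<partial>lborel)"
    unfolding w_def by (rule gagliardo_pow_lift_le[OF p \<eta>_def u(1) \<phi>])
  also have "\<dots> \<le> gagliardo_pow \<sigma> p u + 2 * (ennreal C1 * J)"
    by (intro add_left_mono mult_left_mono upper) simp
  finally have main: "gagliardo_pow \<sigma> p w + 2 * (ennreal C2 * J) \<le> gagliardo_pow \<sigma> p u + 2 * (ennreal C1 * J)" .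
  have u_fin: "gagliardo_pow \<sigma> p u < \<infinity>" using u(2) by (simp add: W0_def)
  \<comment> \<open>The energy estimate itself shows that the lift has finite energy, as its
    membership in \<open>W0\<close> requires.\<close>
  have "gagliardo_pow \<sigma> p w \<le> gagliardo_pow \<sigma> p w + 2 * (ennreal C2 * J)" by simp
  also note main
  also have "gagliardo_pow \<sigma> p u + 2 * (ennreal C1 * J) < \<infinity>"
    using u_fin by (simp add: j ennreal_mult_less_top)
  finally have w_fin: "gagliardo_pow \<sigma> p w < \<infinity>" .
  have "continuous_on UNIV (\<lambda>x. \<bar>w x\<bar> powr p)"
    using p by (intro continuous_on_powr' continuous_intros w_cont) auto
  then have "integrable lborel (\<lambda>x. \<bar>w x\<bar> powr p)"
    by (rule integrable_continuous_bounded_support[OF _ \<Omega>]) (simp add: w_out)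
  then have "w \<in> W0 \<sigma> p \<Omega>"
    using w_cont w_out w_fin by (simp add: W0_def borel_measurable_continuous_onI)
  then have "gagliardo_pow \<sigma> p u \<le> gagliardo_pow \<sigma> p w"
    using min w_cont w_x0 by (simp add: energy_minimizer_def)
  then have "gagliardo_pow \<sigma> p u + 2 * (ennreal C2 * J) \<le> gagliardo_pow \<sigma> p u + 2 * (ennreal C1 * J)"
    using main by (meson add_right_mono order_trans)
  then have "2 * (ennreal C2 * J) \<le> 2 * (ennreal C1 * J)"
    using u_fin by (auto simp: ennreal_add_left_cancel_le)
  then have "ennreal (2 * (C2 * j)) \<le> ennreal (2 * (C1 * j))"
    using C j by (simp add: ennreal_mult)
  then show False using C j by (simp add: mult_le_cancel_right)
qed

text \<open>Subtracting a truncated cone makes a contact at \<open>z\<close> strict. Since min(1, r)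
  \<le> r^\<sigma>, each Hoelder quotient drops by at most \<open>e\<close>, and so do the supremum
  and the infimum. The cone is not differentiable at \<open>z\<close>, which is why the operator
  estimates are stated for bounded Lipschitz functions.\<close>

lemma L_inf_cone_perturbation:
  fixes \<phi> :: "'a::euclidean_space \<Rightarrow> real"
  assumes \<sigma>: "0 < \<sigma>" "\<sigma> < 1" and L: "0 \<le> L" and e: "0 \<le> e"
    and lip: "\<And>x y. \<bar>\<phi> x - \<phi> y\<bar> \<le> L * norm (x - y)" and M: "\<And>x. \<bar>\<phi> x\<bar> \<le> M"
  shows "L_inf \<sigma> \<phi> z - 2 * e \<le> L_inf \<sigma> (\<lambda>x. \<phi> x - e * min 1 (norm (x - z))) z"
    and "\<And>x y. \<bar>(\<phi> x - e * min 1 (norm (x - z))) - (\<phi> y - e * min 1 (norm (y - z)))\<bar> \<le> (L + e) * norm (x - y)"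
    and "\<And>x. \<bar>\<phi> x - e * min 1 (norm (x - z))\<bar> \<le> M + e"
proof -
  define \<psi> where "\<psi> x = \<phi> x - e * min 1 (norm (x - z))" for x
  have lip\<psi>: "\<bar>\<psi> x - \<psi> y\<bar> \<le> (L + e) * norm (x - y)" for x y
  proof -
    have "\<bar>min 1 (norm (x - z)) - min 1 (norm (y - z))\<bar> \<le> norm (x - y)"
      using norm_triangle_ineq3[of "x - z" "y - z"] by (auto simp: min_def)
    then have "\<bar>e * min 1 (norm (x - z)) - e * min 1 (norm (y - z))\<bar> \<le> e * norm (x - y)"
      using e by (simp add: right_diff_distrib[symmetric] abs_mult mult_left_mono)
    then show ?thesis using lip[of x y] by (simp add: \<psi>_def distrib_right)
  qed
  have M\<psi>: "\<bar>\<psi> x\<bar> \<le> M + e" for x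
  proof -
    have "e * min 1 (norm (x - z)) \<le> e * 1" "0 \<le> e * min 1 (norm (x - z))"
      using e by (intro mult_left_mono mult_nonneg_nonneg; simp)+
    then show ?thesis using M[of x] by (auto simp: \<psi>_def)
  qed
  let ?g = "\<lambda>f y. (f y - f z) / norm (y - z) powr \<sigma>"
  have key: "?g \<phi> y - e \<le> ?g \<psi> y" if "y \<noteq> z" for y
  proof -
    define r where "r = norm (y - z)"
    have r: "r > 0" using that by (simp add: r_def)
    have "min 1 r \<le> r powr \<sigma>"
    proof (cases "r \<le> 1")
      case True
      then show ?thesis using r \<sigma> powr_mono'[of \<sigma> 1 r] by simp
    next
      case False
      then show ?thesis using \<sigma> by (simp add: ge_one_powr_ge_zero)
    qed
    then have "e * min 1 r \<le> e * r powr \<sigma>" using e by (rule mult_left_mono)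
    then have "e * min 1 r / r powr \<sigma> \<le> e" using r by (simp add: divide_le_eq)
    then show ?thesis by (simp add: \<psi>_def diff_divide_distrib r_def)
  qed
  obtain b :: 'a where "b \<in> Basis" using nonempty_Basis by blast
  then have "z + b \<in> UNIV - {z}" by (auto simp: nonzero_Basis)
  then have ne: "UNIV - {z} \<noteq> {}" by blast
  have Le: "0 \<le> L + e" using L e by simp
  note bdd = holder_quotient_bounded[OF \<sigma> L lip M, of z]
  note bdd\<psi> = holder_quotient_bounded[OF \<sigma> Le lip\<psi> M\<psi>, of z]
  have "(SUP y\<in>UNIV - {z}. ?g \<phi> y) \<le> (SUP y\<in>UNIV - {z}. ?g \<psi> y) + e"
  proof (rule cSUP_least[OF ne])
    fix y assume y: "y \<in> UNIV - {z}"
    then have "?g \<psi> y \<le> (SUP y\<in>UNIV - {z}. ?g \<psi> y)" by (intro cSUP_upper bdd\<psi>)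
    then show "?g \<phi> y \<le> (SUP y\<in>UNIV - {z}. ?g \<psi> y) + e" using key[of y] y by simp
  qed
  moreover have "(INF y\<in>UNIV - {z}. ?g \<phi> y) - e \<le> (INF y\<in>UNIV - {z}. ?g \<psi> y)"
  proof (rule cINF_greatest[OF ne])
    fix y assume y: "y \<in> UNIV - {z}"
    then have "(INF y\<in>UNIV - {z}. ?g \<phi> y) \<le> ?g \<phi> y" by (intro cINF_lower bdd)
    then show "(INF y\<in>UNIV - {z}. ?g \<phi> y) - e \<le> ?g \<psi> y" using key[of y] y by simp
  qed
  ultimately have "L_inf \<sigma> \<phi> z - 2 * e \<le> L_inf \<sigma> \<psi> z" unfolding L_inf_def by linarith
  then show "L_inf \<sigma> \<phi> z - 2 * e \<le> L_inf \<sigma> (\<lambda>x. \<phi> x - e * min 1 (norm (x - z))) z"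
    unfolding \<psi>_def[abs_def] .
  show "\<bar>(\<phi> x - e * min 1 (norm (x - z))) - (\<phi> y - e * min 1 (norm (y - z)))\<bar> \<le> (L + e) * norm (x - y)" for x y
    using lip\<psi> unfolding \<psi>_def .
  show "\<bar>\<phi> x - e * min 1 (norm (x - z))\<bar> \<le> M + e" for x
    using M\<psi> unfolding \<psi>_def .
qed

text \<open>If the operator were positive, the gap would hold for large p near \<open>z\<close>,
  while uniform convergence lets a slightly raised, strictly touching function cross
  \<open>u n\<close> only near \<open>z\<close>. That is the excluded lift.\<close>

lemma L_inf_nonpos_of_touching_below:
  fixes u :: "nat \<Rightarrow> 'a::euclidean_space \<Rightarrow> real"
  assumes \<sigma>: "0 < \<sigma>" "\<sigma> < 1" and \<Omega>: "open \<Omega>" "bounded \<Omega>"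
    and p: "filterlim p at_top sequentially"
    and min: "\<And>n. energy_minimizer \<sigma> (p n) \<Omega> x0 (u n)"
    and lim: "uniform_limit UNIV u w sequentially"
    and z: "z \<in> \<Omega> - {x0}" and \<phi>: "\<phi> \<in> C1_compact_support" "\<phi> z = w z" "\<And>x. \<phi> x \<le> w x"
  shows "L_inf \<sigma> \<phi> z \<le> 0"
proof (rule ccontr)
  assume "\<not> L_inf \<sigma> \<phi> z \<le> 0"
  then have pos: "0 < L_inf \<sigma> \<phi> z" by simp
  obtain L M where L: "0 \<le> L" and lip: "\<And>x y. \<bar>\<phi> x - \<phi> y\<bar> \<le> L * norm (x - y)" and M: "\<And>x. \<bar>\<phi> x\<bar> \<le> M"
    using C1_compact_support_lipschitz_bounded[OF \<phi>(1)] by blast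
  \<comment> \<open>The perturbation costs at most \<open>2 * e\<close>, so at least half of the
    positive value survives.\<close>
  define e where "e = L_inf \<sigma> \<phi> z / 4"
  have e: "e > 0" using pos by (simp add: e_def)
  define \<psi> where "\<psi> x = \<phi> x - e * min 1 (norm (x - z))" for x
  note pert = L_inf_cone_perturbation[OF \<sigma> L less_imp_le[OF e] lip M, where z = z, folded \<psi>_def]
  have Le: "0 \<le> L + e" using L e by simp
  have "0 < L_inf \<sigma> \<psi> z" using pert(1) pos e by (simp add: e_def \<psi>_def[abs_def])
  from one_sided_op_gap[OF \<sigma> Le pert(2,3) this] obtain \<rho>1 where \<rho>1: "0 < \<rho>1"
    "eventually (\<lambda>p. \<exists>C1 C2. 0 \<le> C1 \<and> C1 < C2 \<and> (\<forall>x\<in>ball z \<rho>1.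
        one_sided_op \<sigma> p \<psi> x \<le> ennreal C1 \<and> ennreal C2 \<le> one_sided_op \<sigma> p (\<lambda>y. - \<psi> y) x)) at_top"
    by blast
  have "open (\<Omega> - {x0})" using \<Omega> by (intro open_Diff) auto
  then obtain \<rho>2 where \<rho>2: "\<rho>2 > 0" "ball z \<rho>2 \<subseteq> \<Omega> - {x0}" using z openE by blast
  define \<rho> where "\<rho> = min 1 (min \<rho>1 \<rho>2)"
  have \<rho>: "0 < \<rho>" "\<rho> \<le> 1" "\<rho> \<le> \<rho>1" "\<rho> \<le> \<rho>2" using \<rho>1 \<rho>2 by (auto simp: \<rho>_def)
  \<comment> \<open>Outside the ball \<psi> lies at least \<delta> below \<open>w\<close>, as \<rho>
    \<le> 1 keeps the truncation of the cone harmless. With shift \<delta>/4 and uniform error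
    \<delta>/8, the shifted \<psi> is below \<open>u n\<close> outside the ball and above it at
    \<open>z\<close>.\<close>
  define \<delta> where "\<delta> = e * \<rho>"
  have \<delta>: "\<delta> > 0" using e \<rho> by (simp add: \<delta>_def)
  have "eventually (\<lambda>n. \<forall>x\<in>UNIV. dist (u n x) (w x) < \<delta> / 8) sequentially"
    using uniform_limitD[OF lim, of "\<delta> / 8"] \<delta> by auto
  moreover have "eventually (\<lambda>n. 1 < p n) sequentially"
    using p by (simp add: filterlim_at_top_dense)
  moreover note eventually_compose_filterlim[OF \<rho>1(2) p]
  ultimately have "eventually (\<lambda>n. False) sequentially"
  proof eventually_elim
    case (elim n)
    then obtain C1 C2 where C: "0 \<le> C1" "C1 < C2" "\<And>x. x\<in>ball z \<rho>1 \<Longrightarrow>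
        one_sided_op \<sigma> (p n) \<psi> x \<le> ennreal C1 \<and> ennreal C2 \<le> one_sided_op \<sigma> (p n) (\<lambda>y. - \<psi> y) x"
      by blast
    have near: "\<bar>u n x - w x\<bar> < \<delta> / 8" for x using elim by (simp add: dist_real_def)
    show False
    proof (rule energy_minimizer_no_strict_lift[OF min _ \<Omega>(2) _ _ _ _ C(1,2)])
      show "1 < p n" by (fact elim)
      show "continuous_on UNIV \<psi>" using Le pert(2) by (rule lipschitz_imp_continuous)
      show "ball z \<rho> \<subseteq> \<Omega> - {x0}" using \<rho>2 \<rho> by (meson subset_ball subset_trans)
      show "\<psi> x + \<delta> / 4 \<le> u n x" if "x \<notin> ball z \<rho>" for x
      proof -
        have "\<rho> \<le> min 1 (norm (x - z))" using that \<rho> by (simp add: dist_norm norm_minus_commute)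
        then have "\<delta> \<le> e * min 1 (norm (x - z))" unfolding \<delta>_def using e by (intro mult_left_mono) auto
        then show ?thesis using near[of x] \<phi>(3)[of x] \<delta> unfolding \<psi>_def abs_less_iff by linarith
      qed
      show "u n z < \<psi> z + \<delta> / 4" using near[of z] \<phi>(2) \<delta> unfolding \<psi>_def abs_less_iff by simp
      fix x assume "x \<in> ball z \<rho>"
      then have "x \<in> ball z \<rho>1" using \<rho> by simp
      then show "one_sided_op \<sigma> (p n) \<psi> x \<le> ennreal C1" "ennreal C2 \<le> one_sided_op \<sigma> (p n) (\<lambda>y. - \<psi> y) x"
        using C by auto
    qed
  qed
  then show False by simp
qed

section \<open>Sign changes and both viscosity inequalities\<close>

lemma L_inf_uminus: "L_inf \<sigma> (\<lambda>x. - \<phi> x) z = - L_inf \<sigma> \<phi> z"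
proof -
  let ?g = "\<lambda>y. (\<phi> y - \<phi> z) / norm (y - z) powr \<sigma>"
  have "(- \<phi> y - - \<phi> z) / norm (y - z) powr \<sigma> = - ?g y" for y
    by (simp add: diff_divide_distrib)
  \<comment> \<open>For reals the infimum is defined as minus the supremum of the negatives, so
    negation swaps the two terms of the operator.\<close>
  moreover have "(SUP y\<in>UNIV - {z}. - ?g y) = - (INF y\<in>UNIV - {z}. ?g y)"
    by (simp add: Inf_real_def image_image)
  moreover have "(INF y\<in>UNIV - {z}. - ?g y) = - (SUP y\<in>UNIV - {z}. ?g y)"
    by (simp add: Inf_real_def image_image)
  ultimately show ?thesis unfolding L_inf_def by simp
qed

lemma C1_compact_support_uminus:
  assumes "\<phi> \<in> C1_compact_support"
  shows "(\<lambda>x. - \<phi> x) \<in> C1_compact_support"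
proof -
  have d: "\<phi> differentiable (at x)" for x using assms by (simp add: C1_compact_support_def)
  have "frechet_derivative (\<lambda>x. - \<phi> x) (at x) = (\<lambda>e. - frechet_derivative \<phi> (at x) e)" for x
    using has_derivative_minus[OF d[unfolded frechet_derivative_works]] by (rule frechet_derivative_at[symmetric])
  then show ?thesis
    using assms by (auto simp: C1_compact_support_def intro: continuous_on_minus)
qed

lemma uniform_limit_minimizers_solves:
  fixes u :: "nat \<Rightarrow> 'a::euclidean_space \<Rightarrow> real"
  assumes \<sigma>: "0 < \<sigma>" "\<sigma> < 1" and \<Omega>: "open \<Omega>" "bounded \<Omega>"
    and p: "filterlim p at_top sequentially"
    and min: "\<And>n. energy_minimizer \<sigma> (p n) \<Omega> x0 (u n)"
    and lim: "uniform_limit UNIV u w sequentially"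
    and w: "continuous_on UNIV w" "\<And>x. x \<notin> \<Omega> \<Longrightarrow> w x = 0"
  shows "solves_punctured_problem \<sigma> \<Omega> x0 (w x0) w"
proof -
  have "L_inf \<sigma> \<phi> z \<le> 0" if "z \<in> \<Omega> - {x0}" "\<phi> \<in> C1_compact_support" "\<phi> z = w z" "\<forall>x. \<phi> x \<le> w x" for z \<phi>
    using L_inf_nonpos_of_touching_below[OF \<sigma> \<Omega> p min lim] that by blast
  moreover have "0 \<le> L_inf \<sigma> \<phi> z" if "z \<in> \<Omega> - {x0}" "\<phi> \<in> C1_compact_support" "\<phi> z = w z" "\<forall>x. w x \<le> \<phi> x" for z \<phi>
  proof -
    have "L_inf \<sigma> (\<lambda>x. - \<phi> x) z \<le> 0"
      using that
      by (intro L_inf_nonpos_of_touching_below[OF \<sigma> \<Omega> p energy_minimizer_uminus[OF min] uniform_limit_uminus[OF lim]]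
          C1_compact_support_uminus) auto
    then show ?thesis by (simp add: L_inf_uminus)
  qed
  ultimately show ?thesis
    using w by (auto simp: solves_punctured_problem_def viscosity_solution_def
        viscosity_supersolution_def viscosity_subsolution_def)
qed

text \<open>Replacing one component by a function with the same value at its marked point keeps the
  denominator equal to 1, and the energy of the other component cancels in the comparison of
  quotients.\<close>

lemma Lambda1_attained_imp_energy_minimizers:
  assumes uv: "(u, v) \<in> X_star s t p \<Omega> x1 x2" and p: "0 < p"
    and norm1: "\<bar>u x1\<bar> powr \<alpha> p * \<bar>v x2\<bar> powr \<beta> p = 1"
    and min: "Lambda1 s t \<alpha> \<beta> \<Omega> x1 x2 p = Q_quot s t \<alpha> \<beta> x1 x2 p u v"
  shows "energy_minimizer s p \<Omega> x1 u" "energy_minimizer t p \<Omega> x2 v"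
proof -
  have le: "Q_quot s t \<alpha> \<beta> x1 x2 p u v \<le> Q_quot s t \<alpha> \<beta> x1 x2 p f g"
    if "(f, g) \<in> X_star s t p \<Omega> x1 x2" for f g
  proof -
    \<comment> \<open>Nonnegativity of the quotient makes the real \<open>INF\<close> a genuine
      lower bound.\<close>
    have "bdd_below ((\<lambda>(f, g). Q_quot s t \<alpha> \<beta> x1 x2 p f g) ` X_star s t p \<Omega> x1 x2)"
      using p by (intro bdd_belowI2[of _ 0]) (auto simp: Q_quot_def)
    from cINF_lower[OF this that] show ?thesis
      by (simp add: min[symmetric] Lambda1_def)
  qed
  have mem: "u \<in> W0 s p \<Omega>" "continuous_on UNIV u" "v \<in> W0 t p \<Omega>" "continuous_on UNIV v" "u x1 * v x2 \<noteq> 0"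
    using uv by (auto simp: X_star_def X_space_def)
  \<comment> \<open>\<open>enn2real\<close> sends infinity to 0, so an inequality is carried back
    only between finite energies; membership in \<open>W0\<close> supplies the finiteness.\<close>
  have e2r: "a \<le> b" if "enn2real a \<le> enn2real b" "a < \<infinity>" "b < \<infinity>" for a b
    using that ennreal_leI[OF that(1)] by simp
  show "energy_minimizer s p \<Omega> x1 u"
    unfolding energy_minimizer_def
  proof (intro conjI ballI impI mem)
    fix w assume w: "w \<in> W0 s p \<Omega>" "continuous_on UNIV w" "w x1 = u x1"
    then have "(w, v) \<in> X_star s t p \<Omega> x1 x2" using mem by (simp add: X_star_def X_space_def)
    from le[OF this] have "enn2real (gagliardo_pow s p u) \<le> enn2real (gagliardo_pow s p w)"
      using p w(3) norm1 by (simp add: Q_quot_def divide_le_cancel)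
    then show "gagliardo_pow s p u \<le> gagliardo_pow s p w"
      using w(1) mem(1) by (intro e2r) (auto simp: W0_def)
  qed
  show "energy_minimizer t p \<Omega> x2 v"
    unfolding energy_minimizer_def
  proof (intro conjI ballI impI mem)
    fix w assume w: "w \<in> W0 t p \<Omega>" "continuous_on UNIV w" "w x2 = v x2"
    then have "(u, w) \<in> X_star s t p \<Omega> x1 x2" using mem by (simp add: X_star_def X_space_def)
    from le[OF this] have "enn2real (gagliardo_pow t p v) \<le> enn2real (gagliardo_pow t p w)"
      using p w(3) norm1 by (simp add: Q_quot_def divide_le_cancel)
    then show "gagliardo_pow t p v \<le> gagliardo_pow t p w"
      using w(1) mem(3) by (intro e2r) (auto simp: W0_def)
  qed
qed

theorem theorem11:
  fixes \<Omega> :: "'a::euclidean_space set"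
    and s t \<theta> R :: real
    and x1 x2 x_inf y_inf :: 'a
    and \<alpha> \<beta> :: "real \<Rightarrow> real"
    and p :: "nat \<Rightarrow> real"
    and u v :: "nat \<Rightarrow> 'a \<Rightarrow> real"
    and x y :: "nat \<Rightarrow> 'a"
    and k :: "nat \<Rightarrow> nat"
    and u_inf v_inf :: "'a \<Rightarrow> real"
  assumes "bounded_smooth_domain \<Omega>"
    and "0 < s" and "s \<le> t" and "t < 1"
    and "x1 \<in> \<Omega>" and "x2 \<in> \<Omega>" and "x1 \<noteq> x2"
    and "\<And>q. q > real DIM('a) / s \<Longrightarrow> \<alpha> q > 1 \<and> \<beta> q > 1 \<and> \<alpha> q + \<beta> q = q"
    and "((\<lambda>q. \<alpha> q / q) \<longlongrightarrow> \<theta>) at_top" and "0 < \<theta>" and "\<theta> < 1"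
    and "R = inradius \<Omega>"
    and "filterlim p at_top sequentially"
    and "\<And>n. p n > real DIM('a) / s"
    and "\<And>n. (u n, v n) \<in> X_star s t (p n) \<Omega> x1 x2"
    and "\<And>n z. z \<in> \<Omega> \<Longrightarrow> u n z > 0 \<and> v n z > 0"
    and "\<And>n. \<bar>u n x1\<bar> powr \<alpha> (p n) * \<bar>v n x2\<bar> powr \<beta> (p n) = 1"
    and "\<And>n. Lambda1 s t \<alpha> \<beta> \<Omega> x1 x2 (p n) = Q_quot s t \<alpha> \<beta> x1 x2 (p n) (u n) (v n)"
    and "\<And>n z. u n z \<le> u n (x n)" and "\<And>n z. v n z \<le> v n (y n)"
    and "u_inf \<in> holder_space0 s \<Omega>" and "v_inf \<in> holder_space0 s \<Omega>"
    and "strict_mono k"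
    and "uniform_limit UNIV (\<lambda>n. u (k n)) u_inf sequentially"
    and "uniform_limit UNIV (\<lambda>n. v (k n)) v_inf sequentially"
    and "(\<lambda>n. x (k n)) \<longlonglongrightarrow> x_inf" and "x_inf \<in> \<Omega>"
    and "(\<lambda>n. y (k n)) \<longlonglongrightarrow> y_inf" and "y_inf \<in> \<Omega>"
    and "\<And>z. u_inf z \<le> u_inf x_inf" and "\<And>z. v_inf z \<le> v_inf y_inf"
    and "\<And>z. u_inf z \<ge> 0" and "\<And>z. v_inf z \<ge> 0"
    and "\<bar>u_inf x_inf\<bar> powr \<theta> * \<bar>v_inf y_inf\<bar> powr (1 - \<theta>) = 1"
    and "(\<lambda>n. Lambda1 s t \<alpha> \<beta> \<Omega> x1 x2 (p (k n)) powr (1 / p (k n)))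
           \<longlonglongrightarrow> R powr (- (s * \<theta> + (1 - \<theta>) * t))"
    and "max (holder_seminorm s u_inf) (holder_seminorm t v_inf)
           = ennreal (R powr (- (s * \<theta> + (1 - \<theta>) * t)))"
    and "s = t \<Longrightarrow> (\<forall>z. u_inf z \<le> (infdist z (- \<Omega>)) powr s / R powr s
                      \<and> v_inf z \<le> (infdist z (- \<Omega>)) powr s / R powr s)"
  shows "solves_punctured_problem s \<Omega> x1 (u_inf x1) u_inf
       \<and> solves_punctured_problem t \<Omega> x2 (v_inf x2) v_inf"
proof
  have \<Omega>: "open \<Omega>" "bounded \<Omega>" using assms(1) by (auto simp: bounded_smooth_domain_def)
  have pk: "filterlim (\<lambda>n. p (k n)) at_top sequentially"
    using filterlim_compose[OF assms(13) filterlim_subseq[OF assms(23)]] .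
  have p0: "0 < p n" for n
    using assms(14)[of n] divide_nonneg_pos[of "real DIM('a)" s] assms(2) by linarith
  \<comment> \<open>Minimality holds at every index, hence along the subsequence \<open>k\<close> on
    which the uniform limits are taken.\<close>
  note min = Lambda1_attained_imp_energy_minimizers[OF assms(15) p0 assms(17) assms(18)]
  show "solves_punctured_problem s \<Omega> x1 (u_inf x1) u_inf"
    using assms(2-4,21) by (intro uniform_limit_minimizers_solves[OF _ _ \<Omega> pk min(1) assms(24)])
      (auto simp: holder_space0_def)
  show "solves_punctured_problem t \<Omega> x2 (v_inf x2) v_inf"
    using assms(2-4,22) by (intro uniform_limit_minimizers_solves[OF _ _ \<Omega> pk min(2) assms(25)])
      (auto simp: holder_space0_def)
qed

end
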